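(* Let $\mu,k$ be integers with $k\ge0$ and $\mu-2k\ge1$. For a partition $\underline{\lambda}$, one has $\mathcal{D}(\underline{\lambda})=(\mu,\mu-2,\mu-4,\ldots,\mu-2k)$ if and only if $\underline{\lambda}=(\mu,\mu-2,\mu-4,\ldots,\mu-2k+2,\,r(\mu-2k,t))$ for some $t\in\{1,2,\ldots,\mu-2k\}$. Consequently $|\mathcal{D}^{-1}(\mu,\mu-2,\ldots,\mu-2k)|=\mu-2k$.
   Context: $\mathbb{F}$ is an algebraically closed field of characteristic $0$. For a nilpotent matrix $A$, $\mathrm{sh}(A)$ is the partition of $n$ given by its Jordan block sizes; $\mathcal{O}_{\underline{\mu}}$ is the set of nilpotent $n\times n$ matrices of shape $\underline{\mu}$; $\mathcal{N}_B$ is the set of nilpotent matrices commuting with $B$. Partitions of $n$ are ordered by dominance: $(\lambda_1,\ldots,\lambda_t)\le(\mu_1,\ldots,\mu_s)$ iff $\sum_{i\le k}\lambda_i\le\sum_{i\le k}\mu_i$ for all $k$. For a partition $\underline{\lambda}$ of $n$, $\mathcal{D}(\underline{\lambda})$ is the unique maximal partition $\underline{\mu}$ of $n$ such that $\mathcal{O}_{\underline{\mu}}\cap\mathcal{N}_B\neq\emptyset$ for $B$ of shape $\underline{\lambda}$ (equivalently, the shape of a generic element of the irreducible variety $\mathcal{N}_B$). For $1\le t\le m$, $r(m,t)$ is the unique partition of $m$ with exactly $t$ parts whose largest and smallest parts differ by at most $1$ (an almost rectangular partition). *)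

theory Defs
  imports "Jordan_Normal_Form.Jordan_Normal_Form" "HOL-Computational_Algebra.Polynomial"
begin

definition is_partition :: "nat \<Rightarrow> nat list \<Rightarrow> bool" where
  "is_partition m p \<longleftrightarrow> sorted_wrt (\<ge>) p \<and> (\<forall>x\<in>set p. 0 < x) \<and> sum_list p = m"

definition dominated :: "nat list \<Rightarrow> nat list \<Rightarrow> bool" where
  "dominated lam mu \<longleftrightarrow> (\<forall>k. sum_list (take k lam) \<le> sum_list (take k mu))"

definition nilpotent_mat :: "nat \<Rightarrow> 'a :: field mat \<Rightarrow> bool" where
  "nilpotent_mat n A \<longleftrightarrow> A \<in> carrier_mat n n \<and> (\<exists>k. A ^\<^sub>m k = 0\<^sub>m n n)"

definition has_shape :: "'a :: field mat \<Rightarrow> nat list \<Rightarrow> bool" where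
  "has_shape A p \<longleftrightarrow> sorted_wrt (\<ge>) p \<and>
     (\<exists>n_as. jordan_nf A n_as \<and> mset (map fst n_as) = mset p)"

definition nil_comm :: "'a :: field mat \<Rightarrow> 'a mat set" where
  "nil_comm B = {A. nilpotent_mat (dim_row B) A \<and> A * B = B * A}"

definition nil_jordan :: "'a itself \<Rightarrow> nat list \<Rightarrow> 'a :: field mat" where
  "nil_jordan _ lam = jordan_matrix (map (\<lambda>s. (s, 0)) lam)"

text \<open>D(lam): the unique maximal (in dominance order) partition mu of n such that
  O_mu meets N_B, for B of shape lam (here B the nilpotent Jordan matrix of shape lam).\<close>
definition D_part :: "'a :: field itself \<Rightarrow> nat list \<Rightarrow> nat list" where
  "D_part T lam = (let B = nil_jordan T lam; n = sum_list lam;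
      S = {mu. is_partition n mu \<and> (\<exists>A\<in>nil_comm B. has_shape A mu)} in
      THE mu. mu \<in> S \<and> (\<forall>nu\<in>S. dominated mu nu \<longrightarrow> nu = mu))"

definition r_part :: "nat \<Rightarrow> nat \<Rightarrow> nat list" where
  "r_part m t = (THE p. is_partition m p \<and> length p = t \<and> hd p - last p \<le> 1)"

end

theory Submission
  imports Defs "Jordan_Normal_Form.Jordan_Normal_Form_Existence"
begin

text \<open>
  Every element of the nilpotent commutator of the Jordan matrix \<open>B\<close> of shape \<open>\<lambda>\<close> is conjugate, by a
  matrix commuting with \<open>B\<close>, to one in a fixed linear space \<open>U\<close> of nilpotent matrices commuting
  with \<open>B\<close>. On a line in \<open>U\<close> the rank of each power is generically maximal, so some element of \<open>U\<close>
  maximises the ranks of all powers at once; its shape is the maximum \<open>D(\<lambda>)\<close>.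

  With respect to the basis \<open>e(i,s)\<close>, where \<open>i\<close> is a part and \<open>s\<close> the position in its block, \<open>U\<close> maps
  \<open>e(i,s)\<close> into the span of the \<open>e(j,t)\<close> with \<open>t\<close> at least \<open>s\<close> plus a minimal shift depending on \<open>i, j\<close>. If \<open>\<lambda>\<close> is a
  staircase with an almost rectangular last step, the basis has a grading raised by \<open>U\<close> whose
  levels have the sizes \<open>1, 2, \<dots>, k, k + 1, \<dots>, k + 1, k, \<dots>, 1\<close>, and this bounds the rank of \<open>j\<close>-th powers by
  the rank for the staircase shape. Conversely, a chain of basis vectors bounds the largest
  part of \<open>D(\<lambda>)\<close> from below (in characteristic 0 the incidence matrix of the order has enough
  nonzero powers), and a set of parts of \<open>\<lambda>\<close> with differences at least 2 bounds the number of parts of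
  \<open>D(\<lambda>)\<close>. If \<open>D(\<lambda>)\<close> is a staircase, these bounds are tight for the greedy cover of \<open>\<lambda>\<close> by almost rectangular
  pieces and determine \<open>\<lambda>\<close>.
\<close>

section \<open>Rank of a matrix\<close>

text \<open>The nilpotent commutator is not a linear space, so genericity cannot be tested on lines
  inside it. The obstruction sits in the blocks of equal parts: there the leading coefficients form
  an arbitrary nilpotent matrix. Making this matrix strictly triangular yields the linear space
  \<open>U\<close>, whose lines do the work of the irreducibility of the commutator. Shapes are
  compared through the ranks of powers: an inequality between these ranks for all exponents implies
  dominance, and ranks are accessible from below by explicit witnesses and from above by blocks of
  zeros. In the converse direction every chain bounds the largest part of D(\<lambda>), not only the
  chain through the top piece of the greedy cover. A chain through a lower piece picks up two
  vectors from each part above it. Once the sums are tight, a second part in a piece above the last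
  one would make such a chain longer than \<open>mu\<close>. This is why only the last step of the
  staircase can be broken up.\<close>

lemma index_mult_mat_sum:
  assumes "A \<in> carrier_mat n m" "B \<in> carrier_mat m l" "i < n" "j < l"
  shows "(A * B) $$ (i,j) = (\<Sum>k<m. A $$ (i,k) * B $$ (k,j))"
  using assms by (auto simp: scalar_prod_def lessThan_atLeast0)

text \<open>A rank bound is encoded as a factorization of an identity matrix through
  \<open>M\<close>. A pair \<open>P\<close>, \<open>Q\<close> certifies it, and it passes to similar
  matrices by absorbing the conjugating matrices into \<open>P\<close> and \<open>Q\<close>.\<close>

definition rank_at_least :: "'a :: field mat \<Rightarrow> nat \<Rightarrow> bool" where
  "rank_at_least M r \<longleftrightarrow> (\<exists>P Q. P \<in> carrier_mat r (dim_row M) \<and> Q \<in> carrier_mat (dim_col M) r \<and>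
     P * M * Q = 1\<^sub>m r)"

lemma rank_at_leastI:
  assumes "A \<in> carrier_mat n m" "P \<in> carrier_mat r n" "Q \<in> carrier_mat m r" "P * A * Q = 1\<^sub>m r"
  shows "rank_at_least A r"
  using assms unfolding rank_at_least_def by blast

lemma rank_at_leastE:
  assumes "rank_at_least A r" "A \<in> carrier_mat n m"
  obtains P Q where "P \<in> carrier_mat r n" "Q \<in> carrier_mat m r" "P * A * Q = 1\<^sub>m r"
  using assms unfolding rank_at_least_def by (metis carrier_matD)

text \<open>Pad both factors with zeros to square matrices of size \<open>r\<close>. A one-sided
  inverse is two-sided, yet row \<open>s\<close> of the padded right factor is zero, so the reversed
  product has a zero on its diagonal.\<close>

lemma rank_factorization_bound:
  fixes f g :: "nat \<Rightarrow> nat \<Rightarrow> 'a :: field"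
  assumes fg: "\<And>i j. i < r \<Longrightarrow> j < r \<Longrightarrow> (\<Sum>k<s. f i k * g k j) = (if i = j then 1 else 0)"
  shows "r \<le> s"
proof (rule ccontr)
  assume "\<not> r \<le> s"
  hence sr: "s < r" by simp
  define X where "X = mat r r (\<lambda>(i,k). if k < s then f i k else 0)"
  define Y where "Y = mat r r (\<lambda>(k,j). if k < s then g k j else 0)"
  have X: "X \<in> carrier_mat r r" and Y: "Y \<in> carrier_mat r r" by (auto simp: X_def Y_def)
  have "X * Y = 1\<^sub>m r"
  proof (rule eq_matI)
    fix i j assume ij: "i < dim_row (1\<^sub>m r)" "j < dim_col (1\<^sub>m r)"
    hence ij: "i < r" "j < r" by auto
    have "(X * Y) $$ (i,j) = (\<Sum>k<r. X $$ (i,k) * Y $$ (k,j))"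
      by (rule index_mult_mat_sum[OF X Y ij])
    also have "\<dots> = (\<Sum>k<s. f i k * g k j)"
      by (rule sum.mono_neutral_cong_right) (use sr ij in \<open>auto simp: X_def Y_def\<close>)
    finally show "(X * Y) $$ (i,j) = 1\<^sub>m r $$ (i,j)" using fg ij by auto
  qed (use X Y in auto)
  hence "Y * X = 1\<^sub>m r" using mat_mult_left_right_inverse[OF X Y] by simp
  hence "1 = (Y * X) $$ (s, s)" using sr by simp
  also have "\<dots> = (\<Sum>k<r. Y $$ (s,k) * X $$ (k,s))"
    by (rule index_mult_mat_sum[OF Y X sr sr])
  also have "\<dots> = 0" by (rule sum.neutral) (use sr in \<open>auto simp: X_def Y_def\<close>)
  finally show False by simp
qed

lemma rank_factorization_bound_set:
  fixes f :: "nat \<Rightarrow> 'k \<Rightarrow> 'a :: field"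
  assumes fin: "finite I"
    and fg: "\<And>i j. i < r \<Longrightarrow> j < r \<Longrightarrow> (\<Sum>k\<in>I. f i k * g k j) = (if i = j then 1 else 0)"
  shows "r \<le> card I"
proof -
  obtain h where h: "bij_betw h {..<card I} I"
    using ex_bij_betw_nat_finite[OF fin] by (auto simp: lessThan_atLeast0)
  show ?thesis
  proof (rule rank_factorization_bound)
    fix i j assume "i < r" "j < r"
    thus "(\<Sum>k<card I. f i (h k) * g (h k) j) = (if i = j then 1 else 0)"
      using fg sum.reindex_bij_betw[OF h, of "\<lambda>k. f i k * g k j"] by simp
  qed
qed

text \<open>The rows in \<open>P\<close> see only the columns in \<open>Q\<close>. So the identity
  of size \<open>r\<close> factors through the coordinates outside \<open>P\<close> together with
  those in \<open>Q\<close>. All upper bounds for ranks below come from this.\<close>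

lemma rank_at_least_zero_pattern:
  assumes A: "A \<in> carrier_mat n m" and P: "P \<subseteq> {..<n}" and Q: "Q \<subseteq> {..<m}"
    and zero: "\<And>p q. p \<in> P \<Longrightarrow> q < m \<Longrightarrow> q \<notin> Q \<Longrightarrow> A $$ (p,q) = 0"
    and rank: "rank_at_least A r"
  shows "r + card P \<le> n + card Q"
proof -
  obtain X Y where X: "X \<in> carrier_mat r n" and Y: "Y \<in> carrier_mat m r" and XY: "X * A * Y = 1\<^sub>m r"
    by (rule rank_at_leastE[OF rank A])
  have XA: "X * A \<in> carrier_mat r m" and AY: "A * Y \<in> carrier_mat n r" using X A Y by auto
  \<comment> \<open>A coordinate \<open>Inl p\<close> passes through row \<open>p\<close> outside
    \<open>P\<close>; a coordinate \<open>Inr q\<close> collects what all rows in \<open>P\<close>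
    send through column \<open>q\<close>.\<close>
  define f where "f i k = (case k of Inl p \<Rightarrow> X $$ (i,p) | Inr q \<Rightarrow> (\<Sum>p\<in>P. X $$ (i,p) * A $$ (p,q)))"
    for i and k :: "nat + nat"
  define g where "g k j = (case k of Inl p \<Rightarrow> (A * Y) $$ (p,j) | Inr q \<Rightarrow> Y $$ (q,j))"
    for j and k :: "nat + nat"
  have finQ: "finite Q" "finite P" using P Q finite_subset by blast+
  have "r \<le> card (({..<n} - P) <+> Q)"
  proof (rule rank_factorization_bound_set)
    show "finite (({..<n} - P) <+> Q)" using finQ by auto
    fix i j assume ij: "i < r" "j < r"
    have AYe: "(A * Y) $$ (p,j) = (\<Sum>q<m. A $$ (p,q) * Y $$ (q,j))" if "p < n" for p
      by (rule index_mult_mat_sum[OF A Y that ij(2)])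
    have "(\<Sum>k\<in>({..<n} - P) <+> Q. f i k * g k j) =
        (\<Sum>p\<in>{..<n} - P. X $$ (i,p) * (A * Y) $$ (p,j)) +
        (\<Sum>q\<in>Q. (\<Sum>p\<in>P. X $$ (i,p) * A $$ (p,q)) * Y $$ (q,j))"
      using finQ by (subst sum.Plus) (auto simp: f_def g_def)
    also have "(\<Sum>q\<in>Q. (\<Sum>p\<in>P. X $$ (i,p) * A $$ (p,q)) * Y $$ (q,j)) =
        (\<Sum>p\<in>P. X $$ (i,p) * (\<Sum>q\<in>Q. A $$ (p,q) * Y $$ (q,j)))"
      unfolding sum_distrib_left sum_distrib_right by (subst sum.swap) (simp add: mult.assoc)
    also have "\<dots> = (\<Sum>p\<in>P. X $$ (i,p) * (A * Y) $$ (p,j))"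
    proof (rule sum.cong[OF refl])
      fix p assume p: "p \<in> P"
      hence "p < n" using P by auto
      have "(\<Sum>q\<in>Q. A $$ (p,q) * Y $$ (q,j)) = (\<Sum>q<m. A $$ (p,q) * Y $$ (q,j))"
        by (rule sum.mono_neutral_left) (use Q zero[OF p] in auto)
      thus "X $$ (i,p) * (\<Sum>q\<in>Q. A $$ (p,q) * Y $$ (q,j)) = X $$ (i,p) * (A * Y) $$ (p,j)"
        using AYe[OF \<open>p < n\<close>] by simp
    qed
    also have "(\<Sum>p\<in>{..<n} - P. X $$ (i,p) * (A * Y) $$ (p,j)) + (\<Sum>p\<in>P. X $$ (i,p) * (A * Y) $$ (p,j))
        = (\<Sum>p<n. X $$ (i,p) * (A * Y) $$ (p,j))"
      using P by (simp add: sum.subset_diff[OF P])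
    also have "\<dots> = (X * (A * Y)) $$ (i,j)" by (rule index_mult_mat_sum[OF X AY ij, symmetric])
    also have "X * (A * Y) = 1\<^sub>m r" using XY assoc_mult_mat[OF X A Y] by simp
    finally show "(\<Sum>k\<in>({..<n} - P) <+> Q. f i k * g k j) = (if i = j then 1 else 0)"
      using ij by simp
  qed
  also have "\<dots> = n - card P + card Q"
    using finQ P by (simp add: card_Plus card_Diff_subset)
  finally show ?thesis using card_mono[OF _ P] by simp
qed

lemma rank_at_least_le: "A \<in> carrier_mat n m \<Longrightarrow> rank_at_least A r \<Longrightarrow> r \<le> m"
  using rank_at_least_zero_pattern[of A n m "{..<n}" "{..<m}" r] by auto

lemma rank_at_least_similar:
  assumes "similar_mat_wit A B P Q" "rank_at_least A r"
  shows "rank_at_least B r"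
proof -
  define n where "n = dim_row A"
  note w = similar_mat_witD[OF n_def assms(1)]
  obtain X Y where X: "X \<in> carrier_mat r n" and Y: "Y \<in> carrier_mat n r" and XY: "X * A * Y = 1\<^sub>m r"
    using assms(2) w unfolding rank_at_least_def by auto
  note [simp] = assoc_mult_mat[of _ _ n _ n _ n] assoc_mult_mat[of _ _ n _ n _ r]
  have "(X * P) * B * (Q * Y) = 1\<^sub>m r" using XY w X Y by simp
  thus ?thesis unfolding rank_at_least_def using X Y w by (intro exI[of _ "X * P"] exI[of _ "Q * Y"]) auto
qed

lemma rank_at_least_similar_iff:
  "similar_mat_wit A B P Q \<Longrightarrow> rank_at_least A r \<longleftrightarrow> rank_at_least B r"
  using rank_at_least_similar similar_mat_wit_sym by blast

lemma rank_at_least_submatrix: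
  fixes A :: "'a :: field mat"
  assumes A: "A \<in> carrier_mat n m" and p: "\<And>i. i < r \<Longrightarrow> p i < n" and q: "\<And>i. i < r \<Longrightarrow> q i < m"
    and ident: "\<And>i j. i < r \<Longrightarrow> j < r \<Longrightarrow> A $$ (p i, q j) = (if i = j then 1 else 0)"
  shows "rank_at_least A r"
proof -
  define X where "X = mat r n (\<lambda>(i,k). if k = p i then 1 else 0 :: 'a)"
  define Y where "Y = mat m r (\<lambda>(k,j). if k = q j then 1 else 0 :: 'a)"
  have X: "X \<in> carrier_mat r n" and Y: "Y \<in> carrier_mat m r" by (auto simp: X_def Y_def)
  have XA: "(X * A) $$ (i,k) = A $$ (p i, k)" if "i < r" "k < m" for i k
  proof -
    have "(X * A) $$ (i,k) = (\<Sum>l<n. (if l = p i then A $$ (p i,k) else 0))"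
      unfolding index_mult_mat_sum[OF X A that] using that
      by (intro sum.cong) (auto simp: X_def)
    thus ?thesis using p that by simp
  qed
  have XA': "X * A \<in> carrier_mat r m" using X A by auto
  have "X * A * Y = 1\<^sub>m r"
  proof (rule eq_matI)
    fix i j assume "i < dim_row (1\<^sub>m r)" "j < dim_col (1\<^sub>m r)"
    hence ij: "i < r" "j < r" by auto
    have "(X * A * Y) $$ (i,j) = (\<Sum>l<m. (if l = q j then A $$ (p i,l) else 0))"
      unfolding index_mult_mat_sum[OF XA' Y ij] using ij
      by (intro sum.cong) (auto simp: Y_def XA)
    thus "(X * A * Y) $$ (i,j) = 1\<^sub>m r $$ (i,j)" using q ident ij by simp
  qed (use X Y in auto)
  thus ?thesis by (rule rank_at_leastI[OF A X Y])
qed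

lemma rank_at_least_0 [simp]: "rank_at_least A 0"
  by (rule rank_at_least_submatrix[of A "dim_row A" "dim_col A"]) auto

lemma rank_at_least_1I:
  fixes A :: "'a :: field mat"
  assumes A: "A \<in> carrier_mat n m" and "p < n" "q < m" "A $$ (p,q) \<noteq> 0"
  shows "rank_at_least A 1"
proof -
  define X where "X = mat 1 n (\<lambda>(i,k). if k = p then inverse (A $$ (p,q)) else 0)"
  define Y where "Y = mat m 1 (\<lambda>(k,j). if k = q then 1 else 0 :: 'a)"
  have X: "X \<in> carrier_mat 1 n" and Y: "Y \<in> carrier_mat m 1" by (auto simp: X_def Y_def)
  have XA: "(X * A) $$ (0,k) = inverse (A $$ (p,q)) * A $$ (p, k)" if "k < m" for k
  proof -
    have "(X * A) $$ (0,k) = (\<Sum>l<n. (if l = p then inverse (A $$ (p,q)) * A $$ (p, k) else 0))"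
      unfolding index_mult_mat_sum[OF X A _ that, of 0, simplified] using that
      by (intro sum.cong) (auto simp: X_def)
    thus ?thesis using assms that by simp
  qed
  have XA': "X * A \<in> carrier_mat 1 m" using X A by auto
  have "X * A * Y = 1\<^sub>m 1"
  proof (rule eq_matI)
    fix i j assume "i < dim_row (1\<^sub>m 1)" "j < dim_col (1\<^sub>m 1)"
    hence ij: "i < 1" "j < 1" by auto
    have "(X * A * Y) $$ (i,j) = (\<Sum>l<m. (if l = q then inverse (A $$ (p,q)) * A $$ (p,l) else 0))"
      unfolding index_mult_mat_sum[OF XA' Y ij] using ij
      by (intro sum.cong) (auto simp: Y_def XA)
    thus "(X * A * Y) $$ (i,j) = 1\<^sub>m 1 $$ (i,j)" using assms ij by simp
  qed (use X Y in auto)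
  thus ?thesis by (rule rank_at_leastI[OF A X Y])
qed

text \<open>With the witnesses \<open>X\<close>, \<open>Y\<close> for \<open>t0\<close> held fixed,
  the determinant of the compressed power is a polynomial in \<open>t\<close> that equals 1 at
  \<open>t0\<close>. Where it does not vanish, inverting the compression repairs the
  witness.\<close>

lemma rank_at_least_generic:
  fixes A D :: "'a :: field mat"
  assumes A: "A \<in> carrier_mat n n" and D: "D \<in> carrier_mat n n"
    and rank: "rank_at_least ((A + t0 \<cdot>\<^sub>m D) ^\<^sub>m j) r"
  shows "\<exists>f. f \<noteq> 0 \<and> (\<forall>t. poly f t \<noteq> 0 \<longrightarrow> rank_at_least ((A + t \<cdot>\<^sub>m D) ^\<^sub>m j) r)"
proof -
  have Mt: "(A + t \<cdot>\<^sub>m D) ^\<^sub>m j \<in> carrier_mat n n" for t using A D by auto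
  obtain X Y where X: "X \<in> carrier_mat r n" and Y: "Y \<in> carrier_mat n r"
    and XY: "X * (A + t0 \<cdot>\<^sub>m D) ^\<^sub>m j * Y = 1\<^sub>m r"
    by (rule rank_at_leastE[OF rank Mt])
  let ?c = "map_mat (\<lambda>a. [:a:])"
  define M where "M = ?c A + [:0,1:] \<cdot>\<^sub>m ?c D"
  have M: "M \<in> carrier_mat n n" using A D by (auto simp: M_def)
  define f where "f = det (?c X * M ^\<^sub>m j * ?c Y)"
  have eval: "poly f t = det (X * (A + t \<cdot>\<^sub>m D) ^\<^sub>m j * Y)" for t
  proof -
    note hom = poly_hom.semiring_hom_axioms
    note mm = semiring_hom.mat_hom_mult[OF hom]
    have c: "map_mat (\<lambda>p. poly p t) (?c Z) = Z" for Z by (intro eq_matI) auto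
    have MM: "map_mat (\<lambda>p. poly p t) M = A + t \<cdot>\<^sub>m D"
      using A D by (intro eq_matI) (auto simp: M_def)
    have "map_mat (\<lambda>p. poly p t) (?c X * M ^\<^sub>m j * ?c Y) = X * (A + t \<cdot>\<^sub>m D) ^\<^sub>m j * Y"
      using X Y M mm[of "?c X" r n "M ^\<^sub>m j" n] mm[of "?c X * M ^\<^sub>m j" r n "?c Y" r]
      by (simp add: semiring_hom.mat_hom_pow[OF hom M] MM c)
    thus ?thesis unfolding f_def comm_ring_hom.hom_det[OF poly_hom.comm_ring_hom_axioms, symmetric] by simp
  qed
  have "poly f t0 \<noteq> 0" unfolding eval XY by simp
  hence "f \<noteq> 0" by auto
  moreover have "rank_at_least ((A + t \<cdot>\<^sub>m D) ^\<^sub>m j) r" if "poly f t \<noteq> 0" for t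
  proof -
    define N where "N = X * (A + t \<cdot>\<^sub>m D) ^\<^sub>m j * Y"
    have N: "N \<in> carrier_mat r r" using X Y by (auto simp: N_def)
    have "det N \<noteq> 0" using that unfolding eval N_def .
    then obtain N' where N': "N' \<in> carrier_mat r r" "N' * N = 1\<^sub>m r"
      using det_non_zero_imp_unit[OF N] by (auto simp: Units_def ring_mat_def)
    have XM: "X * (A + t \<cdot>\<^sub>m D) ^\<^sub>m j \<in> carrier_mat r n" using X Mt[of t] by (rule mult_carrier_mat)
    have "N' * X * (A + t \<cdot>\<^sub>m D) ^\<^sub>m j * Y = N' * (X * (A + t \<cdot>\<^sub>m D) ^\<^sub>m j) * Y"
      using assoc_mult_mat[OF N'(1) X Mt[of t]] by simp
    also have "\<dots> = N' * N" unfolding N_def by (rule assoc_mult_mat[OF N'(1) XM Y])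
    finally have "(N' * X) * (A + t \<cdot>\<^sub>m D) ^\<^sub>m j * Y = 1\<^sub>m r" using N' by simp
    thus ?thesis by (rule rank_at_leastI[OF Mt mult_carrier_mat[OF N'(1) X] Y])
  qed
  ultimately show ?thesis by auto
qed

section \<open>Jordan matrices and powers of nilpotent matrices\<close>

fun pos :: "nat list \<Rightarrow> nat \<Rightarrow> nat \<times> nat" where
  "pos [] p = (0, p)"
| "pos (a # lam) p = (if p < a then (0, p) else (Suc (fst (pos lam (p - a))), snd (pos lam (p - a))))"

definition enc :: "nat list \<Rightarrow> nat \<Rightarrow> nat \<Rightarrow> nat" where
  "enc lam i s = sum_list (take i lam) + s"

abbreviation row_of :: "nat list \<Rightarrow> nat \<Rightarrow> nat" where "row_of lam p \<equiv> fst (pos lam p)"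
abbreviation off_of :: "nat list \<Rightarrow> nat \<Rightarrow> nat" where "off_of lam p \<equiv> snd (pos lam p)"

lemma pos_enc: "i < length lam \<Longrightarrow> s < lam ! i \<Longrightarrow> pos lam (enc lam i s) = (i, s)"
proof (induction lam arbitrary: i)
  case (Cons a lam)
  thus ?case by (cases i) (auto simp: enc_def)
qed simp

lemma enc_less: "i < length lam \<Longrightarrow> s < lam ! i \<Longrightarrow> enc lam i s < sum_list lam"
proof (induction lam arbitrary: i)
  case (Cons a lam)
  show ?case
  proof (cases i)
    case 0 thus ?thesis using Cons by (auto simp: enc_def)
  next
    case (Suc j) thus ?thesis using Cons.IH[of j] Cons.prems by (auto simp: enc_def)
  qed
qed simp

lemma pos_bounds:
  "p < sum_list lam \<Longrightarrow> row_of lam p < length lam \<and> off_of lam p < lam ! row_of lam p \<and>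
     enc lam (row_of lam p) (off_of lam p) = p"
proof (induction lam arbitrary: p)
  case (Cons a lam)
  show ?case
  proof (cases "p < a")
    case False
    hence "p - a < sum_list lam" using Cons.prems by auto
    from Cons.IH[OF this] False show ?thesis by (auto simp: enc_def)
  qed (auto simp: enc_def)
qed simp

lemmas row_less = pos_bounds[THEN conjunct1]
lemmas off_less = pos_bounds[THEN conjunct2, THEN conjunct1]
lemmas enc_pos = pos_bounds[THEN conjunct2, THEN conjunct2]

lemma bij_betw_pos:
  "bij_betw (\<lambda>p. (row_of lam p, off_of lam p)) {..<sum_list lam} (SIGMA i:{..<length lam}. {..<lam ! i})"
  by (rule bij_betw_byWitness[of _ "\<lambda>z. enc lam (fst z) (snd z)"])
    (auto simp: enc_pos pos_enc enc_less row_less off_less simp del: prod.collapse)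

lemma sum_positions:
  "(\<Sum>p<sum_list lam. g p) = (\<Sum>i<length lam. \<Sum>s<lam ! i. g (enc lam i s))"
proof -
  have "(\<Sum>p<sum_list lam. g p) = (\<Sum>p<sum_list lam. (\<lambda>(i,s). g (enc lam i s)) (row_of lam p, off_of lam p))"
    by (rule sum.cong) (simp_all add: enc_pos case_prod_beta)
  also have "\<dots> = (\<Sum>(i,s)\<in>(SIGMA i:{..<length lam}. {..<lam ! i}). g (enc lam i s))"
    by (rule sum.reindex_bij_betw[OF bij_betw_pos])
  finally show ?thesis by (simp add: sum.Sigma)
qed

text \<open>A partial permutation matrix moving every index along its string; the nilpotent Jordan matrix
  is the case in which the strings are the Jordan blocks and the shift is 1.\<close>

definition shift_mat :: "nat \<Rightarrow> (nat \<Rightarrow> nat) \<Rightarrow> (nat \<Rightarrow> nat) \<Rightarrow> (nat \<Rightarrow> nat) \<Rightarrow> 'a :: semiring_1 mat" where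
  "shift_mat n str lev f = mat n n (\<lambda>(p,q). if str p = str q \<and> lev q = lev p + f (str p) then 1 else 0)"

text \<open>This is used for two different string decompositions of the same index set: the Jordan
  blocks themselves, and the steps of the staircase, where several blocks are woven into one
  string.\<close>

locale strings =
  fixes n l :: nat and str lev len :: "nat \<Rightarrow> nat"
  assumes bij: "bij_betw (\<lambda>p. (str p, lev p)) {..<n} (SIGMA i:{..<l}. {..<len i})"
begin

lemma str_less: "p < n \<Longrightarrow> str p < l" and lev_less: "p < n \<Longrightarrow> lev p < len (str p)"
  using bij_betwE[OF bij] by auto

lemma ex_index:
  assumes "i < l" "v < len i"
  obtains p where "p < n" "str p = i" "lev p = v"
proof -
  have "(i,v) \<in> (\<lambda>p. (str p, lev p)) ` {..<n}"
    using assms bij_betw_imp_surj_on[OF bij] by auto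
  thus ?thesis using that by auto
qed

lemma index_inj: "p < n \<Longrightarrow> q < n \<Longrightarrow> str p = str q \<Longrightarrow> lev p = lev q \<Longrightarrow> p = q"
  using bij_betw_imp_inj_on[OF bij] by (auto simp: inj_on_def)

lemma card_indices: "card {p. p < n \<and> Q (str p) (lev p)} = (\<Sum>i<l. card {v. v < len i \<and> Q i v})"
proof -
  have "bij_betw (\<lambda>p. (str p, lev p)) {p. p < n \<and> Q (str p) (lev p)}
      (SIGMA i:{..<l}. {v. v < len i \<and> Q i v})"
    (is "bij_betw _ ?A ?B")
  proof (rule bij_betw_subset[OF bij])
    show "(\<lambda>p. (str p, lev p)) ` ?A = ?B"
    proof
      show "(\<lambda>p. (str p, lev p)) ` ?A \<subseteq> ?B" by (auto simp: str_less lev_less)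
      show "?B \<subseteq> (\<lambda>p. (str p, lev p)) ` ?A"
      proof
        fix z assume "z \<in> ?B"
        then obtain i v where z: "z = (i,v)" "i < l" "v < len i" "Q i v" by auto
        obtain p where "p < n" "str p = i" "lev p = v" using z(2,3) by (rule ex_index)
        thus "z \<in> (\<lambda>p. (str p, lev p)) ` ?A" using z by (intro image_eqI[of _ _ p]) auto
      qed
    qed
  qed auto
  from bij_betw_same_card[OF this] show ?thesis by simp
qed

lemma card_all: "n = (\<Sum>i<l. len i)"
  using card_indices[of "\<lambda>_ _. True"] by simp

abbreviation S :: "(nat \<Rightarrow> nat) \<Rightarrow> 'a :: semiring_1 mat" where "S \<equiv> shift_mat n str lev"

lemma shift_carrier [simp]: "S f \<in> carrier_mat n n"
  by (simp add: shift_mat_def)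

lemma shift_index: "p < n \<Longrightarrow> q < n \<Longrightarrow>
    S f $$ (p,q) = (if str p = str q \<and> lev q = lev p + f (str p) then 1 else 0)"
  by (simp add: shift_mat_def)

lemma shift_mult: "(S f :: 'a :: semiring_1 mat) * S g = S (\<lambda>i. f i + g i)"
proof (rule eq_matI)
  fix p r assume "p < dim_row (S (\<lambda>i. f i + g i) :: 'a mat)" "r < dim_col (S (\<lambda>i. f i + g i) :: 'a mat)"
  hence pr: "p < n" "r < n" by (auto simp: shift_mat_def)
  have *: "((S f :: 'a mat) * S g) $$ (p,r) = (\<Sum>q<n. S f $$ (p,q) * S g $$ (q,r))"
    using pr by (auto simp: scalar_prod_def lessThan_atLeast0 shift_mat_def)
  show "((S f :: 'a mat) * S g) $$ (p,r) = S (\<lambda>i. f i + g i) $$ (p,r)"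
  proof (cases "str p = str r \<and> lev r = lev p + f (str p) + g (str p)")
    case True
    \<comment> \<open>The intermediate index exists because its level is at most that of
      \<open>r\<close>, which lies on the same string.\<close>
    obtain q where q: "q < n" "str q = str p" "lev q = lev p + f (str p)"
      using ex_index[OF str_less[OF pr(1)], of "lev p + f (str p)"] lev_less[OF pr(2)] True by auto
    have "(\<Sum>q'<n. (S f :: 'a mat) $$ (p,q') * S g $$ (q',r)) = (\<Sum>q'<n. if q' = q then 1 else 0)"
    proof (rule sum.cong[OF refl])
      fix q' assume "q' \<in> {..<n}"
      hence q': "q' < n" by simp
      show "(S f :: 'a mat) $$ (p,q') * S g $$ (q',r) = (if q' = q then 1 else 0)"
      proof (cases "q' = q")
        case False
        hence "str q' \<noteq> str q \<or> lev q' \<noteq> lev q" using index_inj[OF q' q(1)] by blast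
        thus ?thesis using False q pr q' by (auto simp: shift_index)
      qed (use True q pr in \<open>simp add: shift_index\<close>)
    qed
    thus ?thesis unfolding * using q(1) pr True by (auto simp: shift_index)
  next
    case False
    have "(\<Sum>q'<n. (S f :: 'a mat) $$ (p,q') * S g $$ (q',r)) = 0"
      by (rule sum.neutral) (use False pr in \<open>auto simp: shift_index\<close>)
    thus ?thesis unfolding * using pr False by (auto simp: shift_index)
  qed
qed (auto simp: shift_mat_def)

lemma shift_0: "S (\<lambda>_. 0) = 1\<^sub>m n"
  by (rule eq_matI) (auto simp: shift_mat_def dest: index_inj)

lemma shift_pow: "(S f :: 'a :: semiring_1 mat) ^\<^sub>m j = S (\<lambda>i. j * f i)"
proof (induction j)
  case 0
  show ?case using shift_0[where 'a = 'a] by (simp add: shift_mat_def cong: if_cong)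
next
  case (Suc j)
  have "(\<lambda>i. j * f i + f i) = (\<lambda>i. Suc j * f i)" by (auto simp: fun_eq_iff)
  thus ?case using Suc by (simp add: shift_mult)
qed

lemma shift_rank: "rank_at_least (S f :: 'a :: field mat) (\<Sum>i<l. len i - f i)"
proof -
  define E where "E = {p. p < n \<and> lev p + f (str p) < len (str p)}"
  have "card {v. v < len i \<and> v + f i < len i} = len i - f i" for i
  proof -
    have "{v. v < len i \<and> v + f i < len i} = {..<len i - f i}" by auto
    thus ?thesis by simp
  qed
  hence cE: "card E = (\<Sum>i<l. len i - f i)"
    unfolding E_def by (subst card_indices[of "\<lambda>i v. v + f i < len i"]) simp
  have "finite E" by (simp add: E_def)
  then obtain h where h: "bij_betw h {..<card E} E"
    using ex_bij_betw_nat_finite by (auto simp: lessThan_atLeast0)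
  have "\<exists>q. p \<in> E \<longrightarrow> q < n \<and> str q = str p \<and> lev q = lev p + f (str p)" for p
    using str_less ex_index unfolding E_def by (metis (no_types, lifting) mem_Collect_eq)
  then obtain nx where nx: "\<And>p. p \<in> E \<Longrightarrow> nx p < n \<and> str (nx p) = str p \<and> lev (nx p) = lev p + f (str p)"
    by metis
  have hE: "h i \<in> E" if "i < card E" for i using that bij_betwE[OF h] by auto
  have "rank_at_least (S f :: 'a mat) (card E)"
  proof (rule rank_at_least_submatrix[of _ n n])
    fix i assume i: "i < card E"
    show "h i < n" "nx (h i) < n" using hE[OF i] nx by (auto simp: E_def)
    fix j assume j: "j < card E"
    have "str (h i) = str (h j) \<and> lev (h i) = lev (h j) \<longleftrightarrow> i = j"
    proof
      assume "str (h i) = str (h j) \<and> lev (h i) = lev (h j)"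
      hence "h i = h j" using index_inj hE[OF i] hE[OF j] by (simp add: E_def)
      thus "i = j" using bij_betw_imp_inj_on[OF h] i j by (simp add: inj_on_eq_iff)
    qed simp
    thus "(S f :: 'a mat) $$ (h i, nx (h j)) = (if i = j then 1 else 0)"
      using hE[OF i] hE[OF j] nx[OF hE[OF j]] by (auto simp: shift_index E_def)
  qed simp
  thus ?thesis by (simp add: cE)
qed

lemma shift_rank_le:
  assumes "rank_at_least (S f :: 'a :: field mat) r"
  shows "r \<le> (\<Sum>i<l. len i - f i)"
proof -
  define P where "P = {p. p < n \<and> len (str p) \<le> lev p + f (str p)}"
  have "card {v. v < len i \<and> len i \<le> v + f i} = min (len i) (f i)" for i
  proof -
    have "{v. v < len i \<and> len i \<le> v + f i} = {len i - f i..<len i}" by auto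
    thus ?thesis by simp
  qed
  hence cP: "card P = (\<Sum>i<l. min (len i) (f i))"
    unfolding P_def by (subst card_indices[of "\<lambda>i v. len i \<le> v + f i"]) simp
  have "r + card P \<le> n + card ({} :: nat set)"
  proof (rule rank_at_least_zero_pattern[OF shift_carrier _ _ _ assms])
    fix p q assume "p \<in> P" "q < n"
    thus "S f $$ (p,q) = (0 :: 'a)" using lev_less[of q] by (auto simp: P_def shift_index)
  qed (auto simp: P_def)
  moreover have "n = (\<Sum>i<l. len i - f i) + (\<Sum>i<l. min (len i) (f i))"
    unfolding card_all sum.distrib[symmetric] by (rule sum.cong) auto
  ultimately show ?thesis using cP by simp
qed

end

section \<open>Ranks of powers of nilpotent Jordan matrices\<close>

lemma strings_pos: "strings (sum_list lam) (length lam) (row_of lam) (off_of lam) (\<lambda>i. lam ! i)"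
  by unfold_locales (rule bij_betw_pos)

lemma nil_jordan_shift:
  "nil_jordan T lam = shift_mat (sum_list lam) (row_of lam) (off_of lam) (\<lambda>_. 1)"
proof (induction lam)
  case Nil
  show ?case by (auto simp: nil_jordan_def shift_mat_def jordan_matrix_def)
next
  case (Cons a lam)
  have eq: "nil_jordan T (a # lam) = four_block_mat (jordan_block a 0) (0\<^sub>m a (sum_list lam))
     (0\<^sub>m (sum_list lam) a) (nil_jordan T lam)"
    by (simp add: nil_jordan_def jordan_matrix_Cons o_def)
  show ?case unfolding eq Cons.IH
    by (rule eq_matI) (auto simp: shift_mat_def)
qed

text \<open>The rank of the \<open>j\<close>-th power of a nilpotent matrix with block sizes
  \<open>lam\<close>. Truncated subtraction is intended: a block of size at most \<open>j\<close>
  contributes nothing.\<close>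

definition pow_rank :: "nat list \<Rightarrow> nat \<Rightarrow> nat" where
  "pow_rank lam j = sum_list (map (\<lambda>x. x - j) lam)"

lemma pow_rank_nth: "pow_rank lam j = (\<Sum>i<length lam. lam ! i - j)"
  by (simp add: pow_rank_def sum_list_sum_nth lessThan_atLeast0)

lemma nil_jordan_rank: "rank_at_least (nil_jordan T lam ^\<^sub>m j :: 'a :: field mat) (pow_rank lam j)"
  and nil_jordan_rank_le: "rank_at_least (nil_jordan T lam ^\<^sub>m j :: 'a mat) r \<Longrightarrow> r \<le> pow_rank lam j"
proof -
  interpret strings "sum_list lam" "length lam" "row_of lam" "off_of lam" "\<lambda>i. lam ! i"
    by (rule strings_pos)
  show "rank_at_least (nil_jordan T lam ^\<^sub>m j :: 'a mat) (pow_rank lam j)"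
    using shift_rank[of "\<lambda>_. j"] by (simp add: nil_jordan_shift shift_pow pow_rank_nth)
  show "r \<le> pow_rank lam j" if "rank_at_least (nil_jordan T lam ^\<^sub>m j :: 'a mat) r"
    using that shift_rank_le[of "\<lambda>_. j"] by (simp add: nil_jordan_shift shift_pow pow_rank_nth)
qed

text \<open>\<open>has_shape\<close> records block sizes only, so the eigenvalues have to be
  recovered: an eigenvector for \<open>a\<close> satisfies \<open>0 = a ^ k\<close> times
  itself.\<close>

lemma nilpotent_jordan_nf:
  fixes A :: "'a :: field mat"
  assumes nil: "nilpotent_mat n A" and nf: "jordan_nf A n_as"
  shows "jordan_matrix n_as = nil_jordan TYPE('a) (map fst n_as)"
proof -
  obtain k where A: "A \<in> carrier_mat n n" and k: "A ^\<^sub>m k = 0\<^sub>m n n"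
    using nil by (auto simp: nilpotent_mat_def)
  have "a = 0" if "(s,a) \<in> set n_as" for s a
  proof -
    have "s \<noteq> 0" using that nf by (force simp: jordan_nf_def)
    hence "poly (char_poly A) a = 0" unfolding jordan_nf_char_poly[OF nf] poly_prod_list prod_list_zero_iff
      using that by force
    then obtain v where v: "eigenvector A v a"
      using eigenvalue_root_char_poly[OF A] by (auto simp: eigenvalue_def)
    have zm: "0\<^sub>m n n *\<^sub>v v = 0\<^sub>v n"
      using v A by (intro eq_vecI) (auto simp: eigenvector_def)
    have "0\<^sub>v n = a ^ k \<cdot>\<^sub>v v"
      using v k A eigenvector_pow[OF A v, of k] zm by (auto simp: eigenvector_def)
    have "a ^ k = 0"
    proof -
      obtain i where i: "i < n" "v $ i \<noteq> 0"
        using v A by (metis carrier_matD(1) carrier_vecD eigenvector_def eq_vecI index_zero_vec)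
      have "0 = (a ^ k \<cdot>\<^sub>v v) $ i" using i \<open>0\<^sub>v n = a ^ k \<cdot>\<^sub>v v\<close> by (metis index_zero_vec(1))
      thus ?thesis using i v A by (auto simp: eigenvector_def)
    qed
    thus ?thesis by simp
  qed
  hence "map (\<lambda>s. (s,0)) (map fst n_as) = n_as"
    by (auto intro!: map_idI)
  thus ?thesis by (simp add: nil_jordan_def)
qed

lemma shape_rank:
  fixes A :: "'a :: field mat"
  assumes nil: "nilpotent_mat n A" and sh: "has_shape A p"
  shows "rank_at_least (A ^\<^sub>m j) (pow_rank p j)"
    and "rank_at_least (A ^\<^sub>m j) r \<Longrightarrow> r \<le> pow_rank p j"
proof -
  obtain n_as where nf: "jordan_nf A n_as" and ms: "mset (map fst n_as) = mset p"
    using sh by (auto simp: has_shape_def)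
  have eq: "pow_rank (map fst n_as) j = pow_rank p j"
    unfolding pow_rank_def using ms by (metis mset_map sum_mset_sum_list)
  obtain P Q where "similar_mat_wit A (nil_jordan TYPE('a) (map fst n_as)) P Q"
    using nf nilpotent_jordan_nf[OF nil nf] by (auto simp: jordan_nf_def similar_mat_def)
  from rank_at_least_similar_iff[OF similar_mat_wit_pow[OF this]]
  show "rank_at_least (A ^\<^sub>m j) (pow_rank p j)"
    and "rank_at_least (A ^\<^sub>m j) r \<Longrightarrow> r \<le> pow_rank p j"
    using nil_jordan_rank[of "TYPE('a)" "map fst n_as" j] nil_jordan_rank_le[of "TYPE('a)" "map fst n_as" j r]
    by (auto simp: eq)
qed

section \<open>Dominance from ranks of powers\<close>

lemma dominated_antisym:
  assumes "is_partition n p" "is_partition n q" "dominated p q" "dominated q p"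
  shows "p = q"
proof -
  have eq: "sum_list (take k p) = sum_list (take k q)" for k
    using assms(3,4) by (auto simp: dominated_def intro: le_antisym)
  have len: "length a \<le> length b" if ab: "\<And>k. sum_list (take k a) = sum_list (take k b)" and "\<forall>x\<in>set a. 0 < x"
    for a b :: "nat list"
  proof (rule ccontr)
    assume "\<not> length a \<le> length b"
    hence "length b < length a" by simp
    hence "sum_list (take (Suc (length b)) a) = sum_list (take (length b) a) + a ! length b" "0 < a ! length b"
      using that by (auto simp: take_Suc_conv_app_nth)
    thus False using ab[of "length b"] ab[of "Suc (length b)"] by simp
  qed
  have pos: "\<forall>x\<in>set p. 0 < x" "\<forall>x\<in>set q. 0 < x" using assms by (auto simp: is_partition_def)
  have l: "length p = length q" using len[OF eq pos(1)] len[OF eq[symmetric] pos(2)] by simp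
  show ?thesis
  proof (rule nth_equalityI[OF l])
    fix i assume "i < length p"
    thus "p ! i = q ! i" using eq[of i] eq[of "Suc i"] l by (simp add: take_Suc_conv_app_nth)
  qed
qed

text \<open>For every \<open>j\<close>, the first \<open>k\<close> parts of a partition sum to at
  most \<open>k * j\<close> plus the rank of the \<open>j\<close>-th power. For \<open>mu\<close>
  this is an equality at \<open>j = mu ! k\<close>, since the first \<open>k\<close> parts are at
  least \<open>j\<close> and the others at most \<open>j\<close>.\<close>

lemma dominatedI:
  assumes nu: "is_partition n nu" and mu: "is_partition n mu"
    and le: "\<And>j. pow_rank nu j \<le> pow_rank mu j"
  shows "dominated nu mu"
  unfolding dominated_def
proof
  fix k
  show "sum_list (take k nu) \<le> sum_list (take k mu)"
  proof (cases "k < length mu")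
    case False
    \<comment> \<open>Beyond the length of \<open>mu\<close> its prefix sum is all of
      \<open>n\<close>, which no prefix sum of \<open>nu\<close> exceeds.\<close>
    have "sum_list (take k nu) \<le> sum_list (take k nu) + sum_list (drop k nu)" by simp
    also have "\<dots> = n" using nu by (simp add: is_partition_def flip: sum_list_append)
    finally show ?thesis using False mu by (simp add: is_partition_def)
  next
    case True
    define j where "j = mu ! k"
    have sorted: "mu ! b \<le> mu ! a" if "a \<le> b" "b < length mu" for a b
      using mu that by (cases "a = b") (auto simp: is_partition_def sorted_wrt_iff_nth_less)
    have lin: "sum_list xs \<le> length xs * j + sum_list (map (\<lambda>x. x - j) xs)" for xs
      by (induction xs) auto
    have "sum_list (take k nu) \<le> length (take k nu) * j + sum_list (map (\<lambda>x. x - j) (take k nu))"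
      by (rule lin)
    also have "\<dots> \<le> k * j + sum_list (map (\<lambda>x. x - j) (take k nu))" by simp
    also have "sum_list (map (\<lambda>x. x - j) (take k nu)) \<le> pow_rank nu j"
      unfolding pow_rank_def by (subst (2) append_take_drop_id[of k nu, symmetric], subst map_append) simp
    also have "pow_rank nu j \<le> pow_rank mu j" by (rule le)
    also have "pow_rank mu j = sum_list (map (\<lambda>x. x - j) (take k mu)) + sum_list (map (\<lambda>x. x - j) (drop k mu))"
      unfolding pow_rank_def by (subst append_take_drop_id[of k mu, symmetric], subst map_append) simp
    also have "sum_list (map (\<lambda>x. x - j) (drop k mu)) = 0"
      using sorted by (auto simp: j_def in_set_conv_nth)
    also have "k * j + (sum_list (map (\<lambda>x. x - j) (take k mu)) + 0) = sum_list (take k mu)"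
    proof -
      have "sum_list (map (\<lambda>x. x - j) xs) + length xs * j = sum_list xs" if "\<forall>x\<in>set xs. j \<le> x" for xs
        using that by (induction xs) auto
      moreover have "\<forall>x\<in>set (take k mu). j \<le> x"
        using True sorted by (auto simp: j_def in_set_conv_nth)
      ultimately have "sum_list (map (\<lambda>x. x - j) (take k mu)) + length (take k mu) * j = sum_list (take k mu)"
        by blast
      thus ?thesis using True by simp
    qed
    finally show ?thesis by simp
  qed
qed

section \<open>Nilpotent matrices over a field\<close>

text \<open>Block diagonal along the fibres of \<open>c\<close>. With \<open>c\<close> the part
  size, exactly such base changes of the leading coefficients lift to the centraliser.\<close>

definition class_resp :: "(nat \<Rightarrow> 'c) \<Rightarrow> 'a :: zero mat \<Rightarrow> bool" where
  "class_resp c M \<longleftrightarrow> (\<forall>i<dim_row M. \<forall>j<dim_col M. M $$ (i,j) \<noteq> 0 \<longrightarrow> c i = c j)"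

lemma class_resp_mult:
  fixes A B :: "'a :: semiring_0 mat"
  assumes "A \<in> carrier_mat n n" "B \<in> carrier_mat n n" "class_resp c A" "class_resp c B"
  shows "class_resp c (A * B)"
  unfolding class_resp_def
proof (intro allI impI)
  fix i j assume "i < dim_row (A * B)" "j < dim_col (A * B)" and nz: "(A * B) $$ (i,j) \<noteq> 0"
  hence ij: "i < n" "j < n" using assms by auto
  have "(A * B) $$ (i,j) = (\<Sum>k<n. A $$ (i,k) * B $$ (k,j))"
    using assms ij by (auto simp: scalar_prod_def lessThan_atLeast0)
  with nz obtain k where "k < n" "A $$ (i,k) * B $$ (k,j) \<noteq> 0"
    by (metis (no_types, lifting) sum.neutral lessThan_iff)
  thus "c i = c j" using assms ij unfolding class_resp_def by (metis carrier_matD mult_zero_left mult_zero_right)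
qed

lemma class_resp_one: "class_resp c (1\<^sub>m n)"
  by (auto simp: class_resp_def)

lemma class_resp_pow:
  fixes A :: "'a :: semiring_1 mat"
  assumes "A \<in> carrier_mat n n" "class_resp c A"
  shows "class_resp c (A ^\<^sub>m k)"
  by (induction k) (use assms in \<open>auto simp: class_resp_one intro!: class_resp_mult[of _ n]\<close>)

lemma pow_mat_Suc_left:
  fixes A :: "'a :: semiring_1 mat"
  assumes "A \<in> carrier_mat n n"
  shows "A ^\<^sub>m Suc k = A * A ^\<^sub>m k"
proof (induction k)
  case (Suc k)
  have "A ^\<^sub>m Suc (Suc k) = (A * A ^\<^sub>m k) * A" using Suc by simp
  also have "\<dots> = A * A ^\<^sub>m Suc k" using assms by (simp add: assoc_mult_mat[of _ n n _ n _ n])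
  finally show ?case .
qed (use assms in auto)

text \<open>A null vector of \<open>C\<close> supported in the class of the index 0 is the last nonzero vector
  in the orbit of the first basis vector; it becomes the first vector of the new basis.\<close>

lemma nilpotent_deflation:
  fixes C :: "'a :: field mat"
  assumes C: "C \<in> carrier_mat (Suc n) (Suc n)" and nil: "C ^\<^sub>m k = 0\<^sub>m (Suc n) (Suc n)" and cC: "class_resp c C"
  shows "\<exists>T P Q. similar_mat_wit C T P Q \<and> class_resp c P \<and> class_resp c Q \<and> (\<forall>i<Suc n. T $$ (i,0) = 0)"
proof -
  define N where "N = Suc n"
  have C: "C \<in> carrier_mat N N" and N: "0 < N" using C by (auto simp: N_def)
  define i0 where "i0 = (LEAST i. \<forall>p<N. (C ^\<^sub>m i) $$ (p,0) = 0)"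
  have ex: "\<forall>p<N. (C ^\<^sub>m k) $$ (p,0) = 0" using nil by (auto simp: N_def)
  have i0: "\<forall>p<N. (C ^\<^sub>m i0) $$ (p,0) = 0" unfolding i0_def by (rule LeastI[of _ k]) (rule ex)
  have "i0 \<noteq> 0" using i0 C N by (auto intro!: gr0I)
  then obtain i where i: "i0 = Suc i" by (cases i0) auto
  have nz0: "\<not> (\<forall>p<N. (C ^\<^sub>m i) $$ (p,0) = 0)"
    using not_less_Least[of i "\<lambda>i. \<forall>p<N. (C ^\<^sub>m i) $$ (p,0) = 0"] i unfolding i0_def by auto
  define v where "v p = (C ^\<^sub>m i) $$ (p,0)" for p
  obtain m where m: "m < N" "v m \<noteq> 0" using nz0 by (auto simp: v_def)
  have Ci: "C ^\<^sub>m i \<in> carrier_mat N N" using C by simp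
  have vc: "c p = c 0" if "p < N" "v p \<noteq> 0" for p
    using class_resp_pow[OF C cC, of i] that N unfolding class_resp_def v_def carrier_matD[OF Ci] by blast
  have Cv: "(\<Sum>q<N. C $$ (p,q) * v q) = 0" if "p < N" for p
    using i0 that unfolding i pow_mat_Suc_left[OF C] v_def
    by (subst index_mult_mat_sum[OF C Ci that N, symmetric]) auto
  \<comment> \<open>The new basis replaces the unit vector at the pivot \<open>m\<close> of
    \<open>v\<close> by \<open>v\<close> itself. As \<open>v\<close> takes slot 0, the unit vector
    displaced from there moves to slot \<open>m\<close>; this respects classes because
    \<open>c m = c 0\<close>.\<close>
  define \<sigma> where "\<sigma> j = (if j = m then 0 else j)" for j
  have s: "\<sigma> j < N" if "j < N" for j using that by (auto simp: \<sigma>_def)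
  have sm: "\<sigma> j \<noteq> m" if "j \<noteq> 0" for j using that by (auto simp: \<sigma>_def)
  have sinj: "\<sigma> i = \<sigma> j \<longleftrightarrow> i = j" if "i \<noteq> 0" "j \<noteq> 0" for i j using that by (auto simp: \<sigma>_def)
  have sc: "c (\<sigma> j) = c j" for j using vc[OF m] by (auto simp: \<sigma>_def)
  define W where "W = mat N N (\<lambda>(p,j). if j = 0 then v p else if p = \<sigma> j then 1 else 0)"
  \<comment> \<open>The inverse read off coordinatewise: the coefficient of \<open>v\<close> is the
    entry at \<open>m\<close> divided by \<open>v m\<close>, and the remaining coordinates are
    corrected by that multiple of \<open>v\<close>.\<close>
  define R where "R = mat N N (\<lambda>(j,p). if j = 0 then (if p = m then 1 / v m else 0)
     else (if p = \<sigma> j then 1 else 0) - (if p = m then v (\<sigma> j) / v m else 0))"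
  have W: "W \<in> carrier_mat N N" and R: "R \<in> carrier_mat N N" by (auto simp: W_def R_def)
  have Wi: "W $$ (p,j) = (if j = 0 then v p else if p = \<sigma> j then 1 else 0)" if "p < N" "j < N" for p j
    using that by (simp add: W_def)
  have RW: "R * W = 1\<^sub>m N"
  proof (rule eq_matI)
    fix a j assume "a < dim_row (1\<^sub>m N)" "j < dim_col (1\<^sub>m N)"
    hence aj: "a < N" "j < N" by auto
    have "(R * W) $$ (a,j) = (\<Sum>p<N. R $$ (a,p) * W $$ (p,j))"
      by (rule index_mult_mat_sum[OF R W aj])
    also have "\<dots> = (if a = 0 then W $$ (m,j) / v m else W $$ (\<sigma> a, j) - v (\<sigma> a) / v m * W $$ (m,j))"
    proof (cases "a = 0")
      case True
      have "(\<Sum>p<N. R $$ (a,p) * W $$ (p,j)) = (\<Sum>p<N. if p = m then W $$ (m,j) / v m else 0)"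
        using aj True by (intro sum.cong) (auto simp: R_def)
      thus ?thesis using m True by simp
    next
      case False
      have "(\<Sum>p<N. R $$ (a,p) * W $$ (p,j)) = (\<Sum>p<N. (if p = \<sigma> a then W $$ (\<sigma> a,j) else 0)
          - (if p = m then v (\<sigma> a) / v m * W $$ (m,j) else 0))"
        using aj False by (intro sum.cong) (auto simp: R_def algebra_simps)
      thus ?thesis using m False s[OF aj(1)] by (simp add: sum_subtractf)
    qed
    also have "\<dots> = 1\<^sub>m N $$ (a,j)"
      using m aj s[OF aj(1)] sm[of j] sinj[of a j] sm[of a] by (cases "a = 0"; cases "j = 0") (auto simp: Wi)
    finally show "(R * W) $$ (a,j) = 1\<^sub>m N $$ (a,j)" .
  qed (use R W in auto)
  have WR: "W * R = 1\<^sub>m N" using mat_mult_left_right_inverse[OF R W RW] .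
  define T where "T = R * C * W"
  have T: "T \<in> carrier_mat N N" using R C W by (auto simp: T_def)
  note [simp] = assoc_mult_mat[of _ N N _ N _ N]
  have "W * T * R = (W * R) * C * (W * R)" unfolding T_def using W R C by simp
  hence CT: "C = W * T * R" using WR C by simp
  have wit: "similar_mat_wit C T W R" by (rule similar_mat_witI[OF WR RW CT C T W R])
  have CW: "(C * W) $$ (p,0) = 0" if "p < N" for p
  proof -
    have "(C * W) $$ (p,0) = (\<Sum>q<N. C $$ (p,q) * v q)"
      unfolding index_mult_mat_sum[OF C W that N] using N by (intro sum.cong) (auto simp: Wi)
    thus ?thesis using Cv[OF that] by simp
  qed
  have CWc: "C * W \<in> carrier_mat N N" using C W by auto
  have "T $$ (a,0) = 0" if "a < N" for a
  proof -
    have "T = R * (C * W)" unfolding T_def using R C W by simp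
    hence "T $$ (a,0) = (\<Sum>p<N. R $$ (a,p) * (C * W) $$ (p,0))"
      using index_mult_mat_sum[OF R CWc that N] by simp
    thus ?thesis using CW by simp
  qed
  moreover have "class_resp c W" unfolding class_resp_def using vc sc by (auto simp: W_def)
  moreover have "class_resp c R" unfolding class_resp_def
  proof (intro allI impI)
    fix j p assume "j < dim_row R" "p < dim_col R" and nz: "R $$ (j,p) \<noteq> 0"
    hence jp: "j < N" "p < N" using R by auto
    show "c j = c p"
    proof (cases "j = 0")
      case True
      thus ?thesis using nz jp vc[OF m] by (auto simp: R_def split: if_splits)
    next
      case False
      hence "p = \<sigma> j \<or> (p = m \<and> v (\<sigma> j) \<noteq> 0)" using nz jp by (auto simp: R_def split: if_splits)
      thus ?thesis using sc[of j] vc[OF m] vc[OF s[OF jp(1)]] by auto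
    qed
  qed
  ultimately show ?thesis using wit unfolding N_def by blast
qed

text \<open>Deflation clears column 0, so the lower right block \<open>D\<close> of \<open>T\<close>
  satisfies that its powers are the lower right blocks of the powers of \<open>T\<close>. Hence
  \<open>D\<close> is again nilpotent, and induction applies to it with the classes shifted by
  \<open>Suc\<close>.\<close>

lemma nilpotent_triangularise:
  fixes C :: "'a :: field mat"
  assumes "C \<in> carrier_mat n n" "C ^\<^sub>m k = 0\<^sub>m n n" "class_resp c C"
  shows "\<exists>T P Q. similar_mat_wit C T P Q \<and> class_resp c P \<and> class_resp c Q \<and>
    (\<forall>i<n. \<forall>j\<le>i. T $$ (i,j) = 0)"
  using assms
proof (induction n arbitrary: C c)
  case 0
  show ?case
    by (rule exI[of _ C], rule exI[of _ "1\<^sub>m 0"], rule exI[of _ "1\<^sub>m 0"])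
      (use 0 similar_mat_wit_refl[OF 0(1)] in \<open>auto simp: class_resp_one\<close>)
next
  case (Suc n)
  obtain T W R where w: "similar_mat_wit C T W R" and cW: "class_resp c W" and cR: "class_resp c R"
    and T0: "\<And>i. i < Suc n \<Longrightarrow> T $$ (i,0) = 0"
    using nilpotent_deflation[OF Suc.prems] by auto
  note wD = similar_mat_witD2[OF Suc.prems(1) w]
  define D where "D = mat n n (\<lambda>(i,j). T $$ (Suc i, Suc j))"
  define u where "u = mat 1 n (\<lambda>(i,j). T $$ (0, Suc j))"
  have D: "D \<in> carrier_mat n n" and u: "u \<in> carrier_mat 1 n" by (auto simp: D_def u_def)
  have T: "T = four_block_mat (0\<^sub>m 1 1) u (0\<^sub>m n 1) D"
    by (rule eq_matI) (use wD T0 in \<open>auto simp: D_def u_def\<close>)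
  have TC: "T \<in> carrier_mat (Suc n) (Suc n)" by fact
  have "T ^\<^sub>m k = 0\<^sub>m (Suc n) (Suc n)"
    using similar_mat_witD2(3)[OF _ similar_mat_wit_pow[OF similar_mat_wit_sym[OF w], of k], of "Suc n" "Suc n"]
      TC wD Suc.prems(2) by simp
  have Tk: "\<forall>i<n. (T ^\<^sub>m a) $$ (Suc i, 0) = 0 \<and> (\<forall>j<n. (T ^\<^sub>m a) $$ (Suc i, Suc j) = (D ^\<^sub>m a) $$ (i,j))" for a
  proof (induction a)
    case 0
    show ?case using TC D by auto
  next
    case (Suc a)
    have Ta: "T ^\<^sub>m a \<in> carrier_mat (Suc n) (Suc n)" and Da: "D ^\<^sub>m a \<in> carrier_mat n n" using TC D by auto
    have "(T ^\<^sub>m Suc a) $$ (Suc i, j) = (\<Sum>q<n. (D ^\<^sub>m a) $$ (i,q) * T $$ (Suc q, j))" if "i < n" "j < Suc n" for i j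
    proof -
      have "(T ^\<^sub>m Suc a) $$ (Suc i, j) = (\<Sum>q<Suc n. (T ^\<^sub>m a) $$ (Suc i,q) * T $$ (q, j))"
        using index_mult_mat_sum[OF Ta TC, of "Suc i" j] that by simp
      also have "\<dots> = (\<Sum>q<n. (T ^\<^sub>m a) $$ (Suc i,Suc q) * T $$ (Suc q, j))"
        unfolding sum.lessThan_Suc_shift using Suc.IH that by simp
      also have "\<dots> = (\<Sum>q<n. (D ^\<^sub>m a) $$ (i,q) * T $$ (Suc q, j))"
        using Suc.IH that by (intro sum.cong) auto
      finally show ?thesis .
    qed
    moreover have "(D ^\<^sub>m Suc a) $$ (i, j) = (\<Sum>q<n. (D ^\<^sub>m a) $$ (i,q) * T $$ (Suc q, Suc j))" if "i < n" "j < n" for i j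
      using index_mult_mat_sum[OF Da D that] that by (simp add: D_def)
    ultimately show ?case using T0 by simp
  qed
  have Dk: "D ^\<^sub>m k = 0\<^sub>m n n"
  proof (rule eq_matI)
    fix i j assume "i < dim_row (0\<^sub>m n n)" "j < dim_col (0\<^sub>m n n)"
    thus "(D ^\<^sub>m k) $$ (i,j) = 0\<^sub>m n n $$ (i,j)" using Tk[of k] \<open>T ^\<^sub>m k = _\<close> by auto
  qed (use D in auto)
  have cT: "class_resp c T"
  proof -
    have T': "T = R * C * W" using similar_mat_witD2(3)[OF TC similar_mat_wit_sym[OF w]] .
    have "class_resp c (R * C)" by (rule class_resp_mult[OF wD(7) Suc.prems(1) cR Suc.prems(3)])
    thus ?thesis unfolding T' by (rule class_resp_mult[OF mult_carrier_mat[OF wD(7) Suc.prems(1)] wD(6) _ cW])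
  qed
  have cD: "class_resp (c \<circ> Suc) D"
    using cT TC unfolding class_resp_def by (auto simp: D_def)
  obtain T' P' Q' where w': "similar_mat_wit D T' P' Q'" and cP': "class_resp (c \<circ> Suc) P'"
    and cQ': "class_resp (c \<circ> Suc) Q'" and T': "\<And>i j. i < n \<Longrightarrow> j \<le> i \<Longrightarrow> T' $$ (i,j) = 0"
    using Suc.IH[OF D Dk cD] by blast
  note wD' = similar_mat_witD2[OF D w']
  define T2 where "T2 = four_block_mat (0\<^sub>m 1 1) (u * P') (0\<^sub>m n 1) T'"
  define P2 where "P2 = four_block_mat (1\<^sub>m 1) (0\<^sub>m 1 n) (0\<^sub>m n 1) P'"
  define Q2 where "Q2 = four_block_mat (1\<^sub>m 1) (0\<^sub>m 1 n) (0\<^sub>m n 1) Q'"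
  have ur: "u = 1\<^sub>m 1 * (u * P') * Q'"
    using u wD' by (simp add: assoc_mult_mat[of _ 1 n _ n _ n])
  have w2: "similar_mat_wit T T2 P2 Q2"
    unfolding T T2_def P2_def Q2_def
    by (rule similar_mat_wit_four_block[OF similar_mat_wit_refl w' ur])
      (use u D wD' in auto)
  have "similar_mat_wit C T2 (W * P2) (Q2 * R)" by (rule similar_mat_wit_trans[OF w w2])
  moreover have "class_resp c P2" using cP' wD' unfolding class_resp_def P2_def
    by (auto simp: less_Suc_eq_0_disj)
  moreover have "class_resp c Q2" using cQ' wD' unfolding class_resp_def Q2_def
    by (auto simp: less_Suc_eq_0_disj)
  moreover have "P2 \<in> carrier_mat (Suc n) (Suc n)" "Q2 \<in> carrier_mat (Suc n) (Suc n)"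
    using wD' by (auto simp: P2_def Q2_def)
  moreover have "T2 $$ (i,j) = 0" if "i < Suc n" "j \<le> i" for i j
    using that T'[of "i - 1" "j - 1"] wD' by (cases i; cases j) (auto simp: T2_def)
  ultimately show ?case using cW cR wD
    by (intro exI[of _ T2] exI[of _ "W * P2"] exI[of _ "Q2 * R"]) (auto intro!: class_resp_mult[of _ "Suc n"])
qed

text \<open>With a constant class function triangularisation is unrestricted, and a triangular
  matrix has a Jordan form over its own field.\<close>

lemma nilpotent_shape_exists:
  fixes A :: "'a :: field mat"
  assumes nil: "nilpotent_mat n A"
  shows "\<exists>p. is_partition n p \<and> has_shape A p"
proof -
  obtain k where A: "A \<in> carrier_mat n n" and k: "A ^\<^sub>m k = 0\<^sub>m n n"
    using nil by (auto simp: nilpotent_mat_def)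
  have "class_resp (\<lambda>_. ()) A" by (simp add: class_resp_def)
  from nilpotent_triangularise[OF A k this]
  obtain T P Q where w: "similar_mat_wit A T P Q" and T: "\<forall>i<n. \<forall>j\<le>i. T $$ (i,j) = 0"
    by (elim exE conjE)
  note wD = similar_mat_witD2[OF A w]
  have "upper_triangular T" using T wD by auto
  hence "jordan_nf T (triangular_to_jnf_vector T)" by (rule triangular_to_jnf_vector[OF wD(5)])
  then obtain n_as where nf: "jordan_nf T n_as" ..
  have "similar_mat A T" using w unfolding similar_mat_def by (intro exI)
  hence sim: "similar_mat A (jordan_matrix n_as)"
    by (rule similar_mat_trans) (use nf in \<open>simp add: jordan_nf_def\<close>)
  hence nfA: "jordan_nf A n_as" using nf by (simp add: jordan_nf_def)
  define p where "p = rev (sort (map fst n_as))"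
  have ms: "mset p = mset (map fst n_as)" by (simp add: p_def)
  have "sum_list p = sum_list (map fst n_as)" using ms by (metis sum_mset_sum_list)
  also have "\<dots> = dim_row (jordan_matrix n_as)" by simp
  also have "\<dots> = n"
  proof -
    obtain P' Q' where "similar_mat_wit A (jordan_matrix n_as) P' Q'" using sim by (auto simp: similar_mat_def)
    from similar_mat_witD2(5)[OF A this] show ?thesis by (rule carrier_matD)
  qed
  finally have "sum_list p = n" .
  moreover have "sorted_wrt (\<ge>) p" by (simp add: p_def sorted_wrt_rev)
  moreover have "\<forall>x\<in>set p. 0 < x" using nf unfolding jordan_nf_def p_def
    by (metis gr0I set_map set_rev set_sort)
  ultimately have "is_partition n p" "has_shape A p"
    using nfA ms[symmetric] by (auto simp: is_partition_def has_shape_def)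
  thus ?thesis by blast
qed

section \<open>The nilpotent commutator\<close>

text \<open>An entry of the \<open>j\<close>-th power is a sum over walks of \<open>j\<close> steps,
  each of which raises \<open>h\<close> by at least 1.\<close>

lemma raising_pow_entry:
  fixes A :: "'a :: semiring_1 mat" and h :: "nat \<Rightarrow> nat"
  assumes A: "A \<in> carrier_mat n n"
    and raise: "\<And>p q. p < n \<Longrightarrow> q < n \<Longrightarrow> A $$ (p,q) \<noteq> 0 \<Longrightarrow> h p < h q"
  shows "p < n \<Longrightarrow> q < n \<Longrightarrow> (A ^\<^sub>m j) $$ (p,q) \<noteq> 0 \<Longrightarrow> h p + j \<le> h q"
proof (induction j arbitrary: q)
  case 0
  thus ?case using A by (cases "p = q") auto
next
  case (Suc j)
  have Aj: "A ^\<^sub>m j \<in> carrier_mat n n" using A by simp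
  have "(\<Sum>r<n. (A ^\<^sub>m j) $$ (p,r) * A $$ (r,q)) \<noteq> 0"
    using Suc.prems index_mult_mat_sum[OF Aj A Suc.prems(1,2)] by simp
  then obtain r where r: "r < n" "(A ^\<^sub>m j) $$ (p,r) * A $$ (r,q) \<noteq> 0"
    by (metis (no_types, lifting) sum.neutral lessThan_iff)
  hence "(A ^\<^sub>m j) $$ (p,r) \<noteq> 0" "A $$ (r,q) \<noteq> 0" by auto
  thus ?case using Suc.IH[OF Suc.prems(1) r(1)] raise[OF r(1) Suc.prems(2)] by linarith
qed

lemma raising_pow_zero:
  fixes A :: "'a :: semiring_1 mat" and h :: "nat \<Rightarrow> nat"
  assumes A: "A \<in> carrier_mat n n"
    and raise: "\<And>p q. p < n \<Longrightarrow> q < n \<Longrightarrow> A $$ (p,q) \<noteq> 0 \<Longrightarrow> h p < h q"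
    and bound: "\<And>p. p < n \<Longrightarrow> h p < b" and j: "b \<le> j"
  shows "A ^\<^sub>m j = 0\<^sub>m n n"
proof (rule eq_matI)
  fix p q assume "p < dim_row (0\<^sub>m n n)" "q < dim_col (0\<^sub>m n n)"
  hence pq: "p < n" "q < n" by auto
  show "(A ^\<^sub>m j) $$ (p,q) = 0\<^sub>m n n $$ (p,q)"
    using raising_pow_entry[OF A raise pq, where j = j] bound[OF pq(2)] j pq by fastforce
qed (use A in auto)

definition centraliser :: "nat list \<Rightarrow> 'a :: field mat set" where
  "centraliser lam = {A \<in> carrier_mat (sum_list lam) (sum_list lam).
     A * nil_jordan TYPE('a) lam = nil_jordan TYPE('a) lam * A}"

text \<open>A linear space of nilpotent matrices that meets every orbit of nilpotent elements of the
  centraliser.\<close>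

definition triangular_centraliser :: "nat list \<Rightarrow> 'a :: field mat set" where
  "triangular_centraliser lam = {A \<in> centraliser lam. \<forall>i<length lam. \<forall>j\<le>i.
     lam ! i = lam ! j \<longrightarrow> A $$ (enc lam i 0, enc lam j 0) = 0}"

text \<open>The least difference of offsets at which an element of \<open>U\<close> can have a
  nonzero entry from row \<open>i\<close> to row \<open>j\<close>, for sorted \<open>lam\<close>. A
  longer target block forces the difference of the lengths. The 1 matters only among equal parts,
  where it expresses strict triangularity.\<close>

definition min_shift :: "nat list \<Rightarrow> nat \<Rightarrow> nat \<Rightarrow> nat" where
  "min_shift lam i j = (if i < j then 0 else max 1 (lam ! j - lam ! i))"

lemma nil_jordan_carrier: "nil_jordan T lam \<in> carrier_mat (sum_list lam) (sum_list lam)"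
  by (simp add: nil_jordan_shift shift_mat_def)

lemma nil_jordan_entry:
  assumes "p < sum_list lam" "q < sum_list lam"
  shows "nil_jordan T lam $$ (p,q) =
    (if row_of lam p = row_of lam q \<and> off_of lam q = Suc (off_of lam p) then 1 else 0)"
  using assms by (simp add: nil_jordan_shift shift_mat_def)

lemma pos_eq_iff: "p < sum_list lam \<Longrightarrow> i < length lam \<Longrightarrow> s < lam ! i \<Longrightarrow>
    row_of lam p = i \<and> off_of lam p = s \<longleftrightarrow> p = enc lam i s"
  using enc_pos[of p lam] by (auto simp: pos_enc)

lemma nil_jordan_mult_left:
  fixes A :: "'a :: field mat"
  assumes A: "A \<in> carrier_mat (sum_list lam) m" and i: "i < length lam" "s < lam ! i" and q: "q < m"
  shows "(nil_jordan TYPE('a) lam * A) $$ (enc lam i s, q) =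
    (if Suc s < lam ! i then A $$ (enc lam i (Suc s), q) else 0)"
proof -
  have "(nil_jordan TYPE('a) lam * A) $$ (enc lam i s, q) =
      (\<Sum>r<sum_list lam. nil_jordan TYPE('a) lam $$ (enc lam i s, r) * A $$ (r,q))"
    by (rule index_mult_mat_sum[OF nil_jordan_carrier A enc_less[OF i] q])
  also have "\<dots> = (\<Sum>r<sum_list lam. if Suc s < lam ! i \<and> r = enc lam i (Suc s) then A $$ (r,q) else 0)"
  proof (rule sum.cong[OF refl])
    fix r assume "r \<in> {..<sum_list lam}"
    hence r: "r < sum_list lam" by simp
    have "row_of lam r = i \<and> off_of lam r = Suc s \<longleftrightarrow> Suc s < lam ! i \<and> r = enc lam i (Suc s)"
      using pos_eq_iff[OF r i(1), of "Suc s"] off_less[OF r] enc_less[OF i(1), of "Suc s"] pos_enc[OF i(1), of "Suc s"]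
      by metis
    thus "nil_jordan TYPE('a) lam $$ (enc lam i s, r) * A $$ (r,q) =
        (if Suc s < lam ! i \<and> r = enc lam i (Suc s) then A $$ (r,q) else 0)"
      using i r by (auto simp: nil_jordan_entry enc_less pos_enc)
  qed
  also have "\<dots> = (if Suc s < lam ! i then A $$ (enc lam i (Suc s), q) else 0)"
    using enc_less[OF i(1), of "Suc s"] by (cases "Suc s < lam ! i") auto
  finally show ?thesis .
qed

lemma nil_jordan_mult_right:
  fixes A :: "'a :: field mat"
  assumes A: "A \<in> carrier_mat m (sum_list lam)" and i: "i < length lam" "s < lam ! i" and p: "p < m"
  shows "(A * nil_jordan TYPE('a) lam) $$ (p, enc lam i s) =
    (if 0 < s then A $$ (p, enc lam i (s - 1)) else 0)"
proof -
  have "(A * nil_jordan TYPE('a) lam) $$ (p, enc lam i s) =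
      (\<Sum>r<sum_list lam. A $$ (p,r) * nil_jordan TYPE('a) lam $$ (r, enc lam i s))"
    by (rule index_mult_mat_sum[OF A nil_jordan_carrier p enc_less[OF i]])
  also have "\<dots> = (\<Sum>r<sum_list lam. if 0 < s \<and> r = enc lam i (s - 1) then A $$ (p,r) else 0)"
  proof (rule sum.cong[OF refl])
    fix r assume "r \<in> {..<sum_list lam}"
    hence r: "r < sum_list lam" by simp
    have "row_of lam r = i \<and> s = Suc (off_of lam r) \<longleftrightarrow> 0 < s \<and> r = enc lam i (s - 1)"
      using pos_eq_iff[OF r i(1), of "s - 1"] i by auto
    thus "A $$ (p,r) * nil_jordan TYPE('a) lam $$ (r, enc lam i s) =
        (if 0 < s \<and> r = enc lam i (s - 1) then A $$ (p,r) else 0)"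
      using i r by (auto simp: nil_jordan_entry enc_less pos_enc)
  qed
  also have "\<dots> = (if 0 < s then A $$ (p, enc lam i (s - 1)) else 0)"
    using enc_less[OF i(1), of "s - 1"] i(2) by (cases "0 < s") auto
  finally show ?thesis .
qed

text \<open>Multiplying by the Jordan matrix shifts rows on the left and columns on the right. So
  every block is constant along diagonals, with zeros in its first column below the top and in its
  last row before the end.\<close>

lemma centraliser_iff:
  fixes A :: "'a :: field mat"
  assumes A: "A \<in> carrier_mat (sum_list lam) (sum_list lam)"
  shows "A \<in> centraliser lam \<longleftrightarrow> (\<forall>i s j t. i < length lam \<longrightarrow> s < lam ! i \<longrightarrow> j < length lam \<longrightarrow> t < lam ! j \<longrightarrow>
    (if 0 < t then A $$ (enc lam i s, enc lam j (t - 1)) else 0) =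
    (if Suc s < lam ! i then A $$ (enc lam i (Suc s), enc lam j t) else 0))" (is "_ \<longleftrightarrow> ?R")
proof -
  let ?B = "nil_jordan TYPE('a) lam" and ?n = "sum_list lam"
  have "A \<in> centraliser lam \<longleftrightarrow> A * ?B = ?B * A" using A by (simp add: centraliser_def)
  also have "\<dots> \<longleftrightarrow> (\<forall>p<?n. \<forall>q<?n. (A * ?B) $$ (p,q) = (?B * A) $$ (p,q))"
    (is "_ \<longleftrightarrow> ?E")
  proof
    assume ?E
    show "A * ?B = ?B * A"
      by (rule eq_matI) (use \<open>?E\<close> A nil_jordan_carrier[of "TYPE('a)" lam] in auto)
  qed simp
  also have "\<dots> \<longleftrightarrow> (\<forall>i s j t. i < length lam \<longrightarrow> s < lam ! i \<longrightarrow> j < length lam \<longrightarrow> t < lam ! j \<longrightarrow>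
     (A * ?B) $$ (enc lam i s, enc lam j t) = (?B * A) $$ (enc lam i s, enc lam j t))"
    by (metis enc_less enc_pos row_less off_less)
  also have "\<dots> \<longleftrightarrow> ?R"
    using nil_jordan_mult_left[OF A] nil_jordan_mult_right[OF A] by (simp add: enc_less)
  finally show ?thesis .
qed

lemma centraliser_carrier: "A \<in> centraliser lam \<Longrightarrow> A \<in> carrier_mat (sum_list lam) (sum_list lam)"
  by (simp add: centraliser_def)

lemma centraliser_toeplitz:
  assumes A: "A \<in> centraliser lam" and "i < length lam" "j < length lam"
  shows "s + u < lam ! i \<Longrightarrow> t + u < lam ! j \<Longrightarrow>
    A $$ (enc lam i (s + u), enc lam j (t + u)) = A $$ (enc lam i s, enc lam j t)"
proof (induction u)
  case (Suc u)
  note iff = centraliser_iff[OF centraliser_carrier[OF A], THEN iffD1, OF A, rule_format]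
  have "A $$ (enc lam i (s + u), enc lam j (t + u)) = A $$ (enc lam i (Suc (s + u)), enc lam j (Suc (t + u)))"
    using iff[of i "s + u" j "Suc (t + u)"] assms(2,3) Suc.prems by simp
  thus ?case using Suc by simp
qed simp

text \<open>Slide a nonzero entry along its diagonal. If an inequality fails, it runs into the zero
  part of the first column or of the last row of its block.\<close>

lemma centraliser_entry:
  assumes A: "A \<in> centraliser lam" and ij: "i < length lam" "j < length lam" and st: "s < lam ! i" "t < lam ! j"
    and nz: "A $$ (enc lam i s, enc lam j t) \<noteq> 0"
  shows "s \<le> t" and "lam ! j + s \<le> lam ! i + t"
proof -
  note iff = centraliser_iff[OF centraliser_carrier[OF A], THEN iffD1, OF A, rule_format]
  show "s \<le> t"
  proof (rule ccontr)
    assume "\<not> s \<le> t"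
    then obtain u where u: "s = Suc u + t" by (metis add.commute less_imp_Suc_add not_le plus_nat.simps(2))
    have "A $$ (enc lam i s, enc lam j t) = A $$ (enc lam i (Suc u), enc lam j 0)"
      using centraliser_toeplitz[OF A ij, of "Suc u" t 0] st u by simp
    thus False using iff[of i u j 0] ij st u nz by simp
  qed
  show "lam ! j + s \<le> lam ! i + t"
  proof (rule ccontr)
    assume *: "\<not> lam ! j + s \<le> lam ! i + t"
    \<comment> \<open>The number of diagonal steps left until the last row of block
      \<open>i\<close>.\<close>
    define u where "u = lam ! i - 1 - s"
    have u: "s + u = lam ! i - 1" "s + u < lam ! i" "Suc (t + u) < lam ! j" using st * by (auto simp: u_def)
    have "A $$ (enc lam i s, enc lam j t) = A $$ (enc lam i (s + u), enc lam j (t + u))"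
      using centraliser_toeplitz[OF A ij, of s u t] u by simp
    thus False using iff[of i "s + u" j "Suc (t + u)"] ij u nz by (simp split: if_splits)
  qed
qed

lemma triangular_centraliser_entry:
  assumes lam: "sorted_wrt (\<ge>) lam" and A: "A \<in> triangular_centraliser lam"
    and ij: "i < length lam" "j < length lam" and st: "s < lam ! i" "t < lam ! j"
    and nz: "A $$ (enc lam i s, enc lam j t) \<noteq> 0"
  shows "s + min_shift lam i j \<le> t"
proof -
  have C: "A \<in> centraliser lam" using A by (simp add: triangular_centraliser_def)
  note e = centraliser_entry[OF C ij st nz]
  show ?thesis
  proof (cases "j \<le> i \<and> s = t")
    case True
    hence le: "lam ! j \<le> lam ! i" using e by simp
    moreover have "lam ! i \<le> lam ! j"
      using lam True ij by (cases "i = j") (auto simp: sorted_wrt_iff_nth_less)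
    ultimately have "A $$ (enc lam i 0, enc lam j 0) = 0"
      using A True ij by (simp add: triangular_centraliser_def)
    moreover have "A $$ (enc lam i s, enc lam j t) = A $$ (enc lam i 0, enc lam j 0)"
      using centraliser_toeplitz[OF C ij, of 0 s 0] st True by simp
    ultimately show ?thesis using nz by simp
  qed (use e in \<open>auto simp: min_shift_def\<close>)
qed


lemma sum_positions_offset0:
  assumes pos: "\<forall>x\<in>set lam. 0 < x" and g: "\<And>i s. i < length lam \<Longrightarrow> s < lam ! i \<Longrightarrow> 0 < s \<Longrightarrow> g (enc lam i s) = 0"
  shows "(\<Sum>p<sum_list lam. g p) = (\<Sum>i<length lam. g (enc lam i 0) :: 'b :: comm_monoid_add)"
  unfolding sum_positions
proof (rule sum.cong[OF refl])
  fix i assume i: "i \<in> {..<length lam}"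
  hence "0 < lam ! i" using pos by auto
  have "(\<Sum>s<lam ! i. g (enc lam i s)) = (\<Sum>s\<in>{0}. g (enc lam i s))"
    by (rule sum.mono_neutral_right) (use i g \<open>0 < lam ! i\<close> in auto)
  thus "(\<Sum>s<lam ! i. g (enc lam i s)) = g (enc lam i 0)" by simp
qed

lemma triangular_centraliser_raises:
  assumes lam: "sorted_wrt (\<ge>) lam" and A: "A \<in> triangular_centraliser lam"
    and pq: "p < sum_list lam" "q < sum_list lam" and nz: "A $$ (p,q) \<noteq> 0"
    and h: "\<And>i s j t. i < length lam \<Longrightarrow> s < lam ! i \<Longrightarrow> j < length lam \<Longrightarrow> t < lam ! j \<Longrightarrow>
       s + min_shift lam i j \<le> t \<Longrightarrow> h i s < (h j t :: nat)"
  shows "h (row_of lam p) (off_of lam p) < h (row_of lam q) (off_of lam q)"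
  using triangular_centraliser_entry[OF lam A, of "row_of lam p" "row_of lam q" "off_of lam p" "off_of lam q"]
    pos_bounds[OF pq(1)] pos_bounds[OF pq(2)] nz by (intro h) auto

text \<open>The expression encodes the lexicographic order on pairs of offset and row: a permitted
  move raises the offset, or keeps it and goes to a later row. This makes every element of
  \<open>U\<close> nilpotent.\<close>

lemma min_shift_level:
  assumes "i < length lam" "j < length lam" "s + min_shift lam i j \<le> t"
  shows "s * Suc (length lam) + i < t * Suc (length lam) + j"
proof (cases "i < j")
  case True
  have "s * Suc (length lam) \<le> t * Suc (length lam)" by (rule mult_le_mono1) (use assms in linarith)
  thus ?thesis using True by linarith
next
  case False
  hence "Suc s \<le> t" using assms by (simp add: min_shift_def)
  hence "Suc s * Suc (length lam) \<le> t * Suc (length lam)" by (rule mult_le_mono1)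
  thus ?thesis using assms by simp
qed

lemma triangular_centraliser_pow_zero:
  assumes lam: "sorted_wrt (\<ge>) lam" and A: "A \<in> triangular_centraliser lam"
    and j: "sum_list lam * Suc (length lam) \<le> j"
  shows "A ^\<^sub>m j = 0\<^sub>m (sum_list lam) (sum_list lam)"
proof (rule raising_pow_zero[OF _ _ _ j])
  let ?h = "\<lambda>i s. s * Suc (length lam) + i"
  show "A \<in> carrier_mat (sum_list lam) (sum_list lam)"
    using A by (simp add: triangular_centraliser_def centraliser_def)
  fix p assume p: "p < sum_list lam"
  have "lam ! row_of lam p \<le> sum_list lam" using row_less[OF p] by (simp add: member_le_sum_list)
  hence "Suc (off_of lam p) \<le> sum_list lam" using off_less[OF p] by linarith
  hence "Suc (off_of lam p) * Suc (length lam) \<le> sum_list lam * Suc (length lam)" by (rule mult_le_mono1)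
  thus "?h (row_of lam p) (off_of lam p) < sum_list lam * Suc (length lam)" using row_less[OF p] by simp
  fix q assume q: "q < sum_list lam" and nz: "A $$ (p,q) \<noteq> 0"
  show "?h (row_of lam p) (off_of lam p) < ?h (row_of lam q) (off_of lam q)"
  proof (rule triangular_centraliser_raises[OF lam A p q nz, where h = ?h])
    fix i s j t assume *: "i < length lam" "j < length lam" "s + min_shift lam i j \<le> t"
    thus "?h i s < ?h j t" by (rule min_shift_level)
  qed
qed

section \<open>The semisimple quotient of the centraliser and its lift\<close>

definition leading_coeffs :: "nat list \<Rightarrow> 'a :: zero mat \<Rightarrow> 'a mat" where
  "leading_coeffs lam A = mat (length lam) (length lam)
     (\<lambda>(i,j). if lam ! i = lam ! j then A $$ (enc lam i 0, enc lam j 0) else 0)"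

text \<open>Lifts a class-respecting matrix to the centraliser by letting it act on the blocks in
  the same way at every offset.\<close>

definition inflate :: "nat list \<Rightarrow> 'a :: zero mat \<Rightarrow> 'a mat" where
  "inflate lam Q = mat (sum_list lam) (sum_list lam)
     (\<lambda>(p,q). if off_of lam p = off_of lam q then Q $$ (row_of lam p, row_of lam q) else 0)"

lemma leading_coeffs_carrier [simp]: "leading_coeffs lam A \<in> carrier_mat (length lam) (length lam)"
  by (simp add: leading_coeffs_def)

lemma inflate_carrier [simp]: "inflate lam A \<in> carrier_mat (sum_list lam) (sum_list lam)"
  by (simp add: inflate_def)

lemma inflate_entry:
  "i < length lam \<Longrightarrow> s < lam ! i \<Longrightarrow> j < length lam \<Longrightarrow> t < lam ! j \<Longrightarrow>
    inflate lam Q $$ (enc lam i s, enc lam j t) = (if s = t then Q $$ (i,j) else 0)"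
  by (simp add: inflate_def enc_less pos_enc)

lemma centraliser_one: "1\<^sub>m (sum_list lam) \<in> centraliser lam"
  by (simp add: centraliser_def left_mult_one_mat[OF nil_jordan_carrier] right_mult_one_mat[OF nil_jordan_carrier])

lemma centraliser_mult:
  fixes X Y :: "'a :: field mat"
  assumes "X \<in> centraliser lam" "Y \<in> centraliser lam"
  shows "X * Y \<in> centraliser lam"
proof -
  let ?B = "nil_jordan TYPE('a) lam"
  note B = nil_jordan_carrier[of "TYPE('a)" lam]
  note c = centraliser_carrier[OF assms(1)] centraliser_carrier[OF assms(2)]
  have "X * Y * ?B = X * (Y * ?B)" by (rule assoc_mult_mat[OF c B])
  also have "\<dots> = X * (?B * Y)" using assms by (simp add: centraliser_def)
  also have "\<dots> = (X * ?B) * Y" by (rule assoc_mult_mat[OF c(1) B c(2), symmetric])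
  also have "\<dots> = (?B * X) * Y" using assms by (simp add: centraliser_def)
  also have "\<dots> = ?B * (X * Y)" by (rule assoc_mult_mat[OF B c])
  finally show ?thesis using c by (simp add: centraliser_def)
qed

lemma centraliser_pow: "X \<in> centraliser lam \<Longrightarrow> X ^\<^sub>m k \<in> centraliser lam"
  by (induction k) (auto simp: centraliser_one[of lam] centraliser_mult dest: centraliser_carrier)

text \<open>Leading coefficients form the quotient map to a product of full matrix algebras, one for
  each part size. It is multiplicative because an intermediate index of positive offset cannot lead
  back to offset 0, and at offset 0 the part sizes cannot increase along the two factors, so between
  equal parts they stay constant.\<close>

lemma leading_coeffs_mult:
  fixes X Y :: "'a :: field mat"
  assumes pos: "\<forall>x\<in>set lam. 0 < x" and X: "X \<in> centraliser lam" and Y: "Y \<in> centraliser lam"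
  shows "leading_coeffs lam (X * Y) = leading_coeffs lam X * leading_coeffs lam Y" (is "?L = ?R")
proof (rule eq_matI)
  fix i j assume "i < dim_row ?R" "j < dim_col ?R"
  hence ij: "i < length lam" "j < length lam" by (auto simp: leading_coeffs_def)
  have p: "0 < lam ! i" if "i < length lam" for i using pos that by auto
  note c = centraliser_carrier[OF X] centraliser_carrier[OF Y]
  have R: "?R $$ (i,j) = (\<Sum>k<length lam. leading_coeffs lam X $$ (i,k) * leading_coeffs lam Y $$ (k,j))"
    by (rule index_mult_mat_sum[OF _ _ ij]) simp_all
  show "?L $$ (i,j) = ?R $$ (i,j)"
  proof (cases "lam ! i = lam ! j")
    case True
    have "?L $$ (i,j) = (X * Y) $$ (enc lam i 0, enc lam j 0)"
      using ij True by (simp add: leading_coeffs_def)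
    also have "\<dots> = (\<Sum>q<sum_list lam. X $$ (enc lam i 0, q) * Y $$ (q, enc lam j 0))"
      by (rule index_mult_mat_sum[OF c]) (use ij p enc_less in auto)
    also have "\<dots> = (\<Sum>k<length lam. X $$ (enc lam i 0, enc lam k 0) * Y $$ (enc lam k 0, enc lam j 0))"
    proof (rule sum_positions_offset0[OF pos])
      fix k s assume "k < length lam" "s < lam ! k" "0 < s"
      thus "X $$ (enc lam i 0, enc lam k s) * Y $$ (enc lam k s, enc lam j 0) = 0"
        using centraliser_entry(1)[OF Y, of k j s 0] ij p by auto
    qed
    also have "\<dots> = ?R $$ (i,j)" unfolding R
    proof (rule sum.cong[OF refl])
      fix k assume "k \<in> {..<length lam}"
      hence k: "k < length lam" by simp
      show "X $$ (enc lam i 0, enc lam k 0) * Y $$ (enc lam k 0, enc lam j 0) =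
          leading_coeffs lam X $$ (i,k) * leading_coeffs lam Y $$ (k,j)"
      proof (cases "lam ! k = lam ! i")
        case eq: True
        thus ?thesis using k ij True by (simp add: leading_coeffs_def)
      next
        case False
        have "X $$ (enc lam i 0, enc lam k 0) = 0 \<or> Y $$ (enc lam k 0, enc lam j 0) = 0"
          using centraliser_entry(2)[OF X ij(1) k p[OF ij(1)] p[OF k]]
            centraliser_entry(2)[OF Y k ij(2) p[OF k] p[OF ij(2)]] False True by linarith
        thus ?thesis using k ij False True by (auto simp: leading_coeffs_def)
      qed
    qed
    finally show ?thesis .
  next
    case False
    hence "?R $$ (i,j) = 0" unfolding R by (intro sum.neutral) (use ij in \<open>auto simp: leading_coeffs_def\<close>)
    thus ?thesis using False ij by (simp add: leading_coeffs_def)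
  qed
qed (auto simp: leading_coeffs_def)

lemma leading_coeffs_one:
  assumes pos: "\<forall>x\<in>set lam. 0 < x"
  shows "leading_coeffs lam (1\<^sub>m (sum_list lam) :: 'a :: field mat) = 1\<^sub>m (length lam)"
proof (rule eq_matI)
  fix i j assume "i < dim_row (1\<^sub>m (length lam) :: 'a mat)" "j < dim_col (1\<^sub>m (length lam) :: 'a mat)"
  hence ij: "i < length lam" "j < length lam" by auto
  hence p: "0 < lam ! i" "0 < lam ! j" using pos by auto
  have "enc lam i 0 = enc lam j 0 \<longleftrightarrow> i = j" using pos_enc[OF ij(1) p(1)] pos_enc[OF ij(2) p(2)] by (metis prod.inject)
  thus "leading_coeffs lam (1\<^sub>m (sum_list lam)) $$ (i,j) = (1\<^sub>m (length lam) :: 'a mat) $$ (i,j)"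
    using ij p by (auto simp: leading_coeffs_def enc_less)
qed (auto simp: leading_coeffs_def)

lemma leading_coeffs_pow:
  fixes X :: "'a :: field mat"
  assumes pos: "\<forall>x\<in>set lam. 0 < x" and X: "X \<in> centraliser lam"
  shows "leading_coeffs lam (X ^\<^sub>m k) = leading_coeffs lam X ^\<^sub>m k"
proof (induction k)
  case 0
  show ?case using leading_coeffs_one[OF pos] carrier_matD[OF centraliser_carrier[OF X]]
      carrier_matD[OF leading_coeffs_carrier[of lam X]] by simp
next
  case (Suc k)
  thus ?case using leading_coeffs_mult[OF pos centraliser_pow[OF X] X, of k] by simp
qed

lemma class_resp_leading_coeffs: "class_resp (\<lambda>i. lam ! i) (leading_coeffs lam X)"
  by (auto simp: class_resp_def leading_coeffs_def)

lemma inflate_centraliser: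
  fixes Q :: "'a :: field mat"
  assumes Q: "Q \<in> carrier_mat (length lam) (length lam)" and c: "class_resp (\<lambda>i. lam ! i) Q"
  shows "inflate lam Q \<in> centraliser lam"
  unfolding centraliser_iff[OF inflate_carrier]
proof (intro allI impI)
  fix i s j t assume i: "i < length lam" "s < lam ! i" and j: "j < length lam" "t < lam ! j"
  have "Q $$ (i,j) \<noteq> 0 \<Longrightarrow> lam ! i = lam ! j" using c Q i j by (auto simp: class_resp_def)
  thus "(if 0 < t then inflate lam Q $$ (enc lam i s, enc lam j (t - 1)) else 0) =
     (if Suc s < lam ! i then inflate lam Q $$ (enc lam i (Suc s), enc lam j t) else 0)"
    using i j by (cases "lam ! i = lam ! j") (auto simp: inflate_entry)
qed

lemma inflate_mult:
  fixes Q R :: "'a :: field mat"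
  assumes Q: "Q \<in> carrier_mat (length lam) (length lam)" and R: "R \<in> carrier_mat (length lam) (length lam)"
    and c: "class_resp (\<lambda>i. lam ! i) Q"
  shows "inflate lam Q * inflate lam R = inflate lam (Q * R)"
proof (rule eq_matI)
  fix p q assume "p < dim_row (inflate lam (Q * R))" "q < dim_col (inflate lam (Q * R))"
  hence pq: "p < sum_list lam" "q < sum_list lam" by (auto simp: inflate_def)
  let ?i = "row_of lam p" and ?s = "off_of lam p" and ?j = "row_of lam q" and ?t = "off_of lam q"
  have ij: "?i < length lam" "?j < length lam" "?s < lam ! ?i" "?t < lam ! ?j"
    using pq row_less off_less by auto
  have "(inflate lam Q * inflate lam R) $$ (p,q) = (\<Sum>r<sum_list lam. inflate lam Q $$ (p,r) * inflate lam R $$ (r,q))"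
    by (rule index_mult_mat_sum[OF inflate_carrier inflate_carrier pq])
  also have "\<dots> = (\<Sum>k<length lam. \<Sum>u<lam ! k. inflate lam Q $$ (p,enc lam k u) * inflate lam R $$ (enc lam k u,q))"
    by (rule sum_positions)
  also have "\<dots> = (\<Sum>k<length lam. if ?s = ?t then Q $$ (?i,k) * R $$ (k,?j) else 0)"
  proof (rule sum.cong[OF refl])
    fix k assume "k \<in> {..<length lam}"
    hence k: "k < length lam" by simp
    have "(\<Sum>u<lam ! k. inflate lam Q $$ (p,enc lam k u) * inflate lam R $$ (enc lam k u,q)) =
       (\<Sum>u<lam ! k. if u = ?s then (if ?s = ?t then Q $$ (?i,k) * R $$ (k,?j) else 0) else 0)"
      using pq k by (intro sum.cong) (auto simp: inflate_def enc_less pos_enc)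
    also have "\<dots> = (if ?s < lam ! k then (if ?s = ?t then Q $$ (?i,k) * R $$ (k,?j) else 0) else 0)"
      by simp
    also have "\<dots> = (if ?s = ?t then Q $$ (?i,k) * R $$ (k,?j) else 0)"
      using c Q k ij by (cases "lam ! k = lam ! ?i") (force simp: class_resp_def)+
    finally show "(\<Sum>u<lam ! k. inflate lam Q $$ (p,enc lam k u) * inflate lam R $$ (enc lam k u,q)) =
       (if ?s = ?t then Q $$ (?i,k) * R $$ (k,?j) else 0)" .
  qed
  also have "\<dots> = inflate lam (Q * R) $$ (p,q)"
    using index_mult_mat_sum[OF Q R ij(1,2)] pq by (auto simp: inflate_def)
  finally show "(inflate lam Q * inflate lam R) $$ (p,q) = inflate lam (Q * R) $$ (p,q)" .
qed (auto simp: inflate_def)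

lemma inflate_one: "inflate lam (1\<^sub>m (length lam) :: 'a :: field mat) = 1\<^sub>m (sum_list lam)"
proof (rule eq_matI)
  fix p q assume "p < dim_row (1\<^sub>m (sum_list lam) :: 'a mat)" "q < dim_col (1\<^sub>m (sum_list lam) :: 'a mat)"
  hence pq: "p < sum_list lam" "q < sum_list lam" by auto
  have "row_of lam p = row_of lam q \<and> off_of lam p = off_of lam q \<longleftrightarrow> p = q"
    using enc_pos[OF pq(1)] enc_pos[OF pq(2)] by metis
  thus "inflate lam (1\<^sub>m (length lam)) $$ (p,q) = (1\<^sub>m (sum_list lam) :: 'a mat) $$ (p,q)"
    using pq row_less by (auto simp: inflate_def)
qed (auto simp: inflate_def)

lemma leading_coeffs_inflate:
  assumes pos: "\<forall>x\<in>set lam. 0 < x" and Q: "Q \<in> carrier_mat (length lam) (length lam)"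
    and c: "class_resp (\<lambda>i. lam ! i) Q"
  shows "leading_coeffs lam (inflate lam Q) = Q"
proof (rule eq_matI)
  fix i j assume "i < dim_row Q" "j < dim_col Q"
  hence ij: "i < length lam" "j < length lam" using Q by auto
  thus "leading_coeffs lam (inflate lam Q) $$ (i,j) = Q $$ (i,j)"
    using c Q pos by (auto simp: leading_coeffs_def inflate_entry class_resp_def)
qed (use Q in \<open>auto simp: leading_coeffs_def\<close>)

lemma nil_comm_conv_centraliser:
  "A \<in> nil_comm (nil_jordan TYPE('a) lam) \<longleftrightarrow> nilpotent_mat (sum_list lam) A \<and> A \<in> centraliser lam"
  for A :: "'a :: field mat"
  using nil_jordan_carrier[of "TYPE('a)" lam]
  by (auto simp: nil_comm_def centraliser_def nilpotent_mat_def)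

lemma triangular_centraliser_nil_comm:
  fixes A :: "'a :: field mat"
  assumes "sorted_wrt (\<ge>) lam" "A \<in> triangular_centraliser lam"
  shows "A \<in> nil_comm (nil_jordan TYPE('a) lam)"
  using triangular_centraliser_pow_zero[OF assms order_refl] assms(2)
  by (auto simp: nil_comm_conv_centraliser nilpotent_mat_def triangular_centraliser_def centraliser_def)

text \<open>The leading coefficients of a nilpotent element are nilpotent. A class-respecting matrix
  that triangularises them inflates to an invertible element of the centraliser, and conjugation by
  it moves \<open>A\<close> into \<open>U\<close>.\<close>

lemma nil_comm_conjugate_triangular:
  fixes A :: "'a :: field mat"
  assumes pos: "\<forall>x\<in>set lam. 0 < x" and A: "A \<in> nil_comm (nil_jordan TYPE('a) lam)"
  obtains A' P Q where "A' \<in> triangular_centraliser lam" "similar_mat_wit A A' P Q"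
proof -
  let ?l = "length lam" and ?n = "sum_list lam" and ?c = "\<lambda>i. lam ! i"
  obtain k where k: "A ^\<^sub>m k = 0\<^sub>m ?n ?n" and AC: "A \<in> centraliser lam"
    using A by (auto simp: nil_comm_conv_centraliser nilpotent_mat_def)
  note Ac = centraliser_carrier[OF AC]
  define C where "C = leading_coeffs lam A"
  have C: "C \<in> carrier_mat ?l ?l" by (simp add: C_def)
  have "C ^\<^sub>m k = leading_coeffs lam (0\<^sub>m ?n ?n)"
    unfolding C_def leading_coeffs_pow[OF pos AC, symmetric] k ..
  also have "\<dots> = 0\<^sub>m ?l ?l"
    by (rule eq_matI) (use pos in \<open>auto simp: leading_coeffs_def enc_less\<close>)
  finally have Ck: "C ^\<^sub>m k = 0\<^sub>m ?l ?l" .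
  have "class_resp ?c C" unfolding C_def by (rule class_resp_leading_coeffs)
  from nilpotent_triangularise[OF C Ck this]
  obtain T P Q where w: "similar_mat_wit C T P Q" and cP: "class_resp ?c P" and cQ: "class_resp ?c Q"
    and T: "\<forall>i<?l. \<forall>j\<le>i. T $$ (i,j) = 0"
    by (elim exE conjE)
  note wD = similar_mat_witD2[OF C w]
  let ?P = "inflate lam P" and ?Q = "inflate lam Q"
  have PC: "?P \<in> centraliser lam" and QC: "?Q \<in> centraliser lam"
    using inflate_centraliser cP cQ wD by auto
  have PQ: "?P * ?Q = 1\<^sub>m ?n" and QP: "?Q * ?P = 1\<^sub>m ?n"
    using inflate_mult[OF wD(6,7) cP] inflate_mult[OF wD(7,6) cQ] wD inflate_one[of lam, where 'a = 'a] by auto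
  define A' where "A' = ?Q * A * ?P"
  have A'C: "A' \<in> centraliser lam" unfolding A'_def by (intro centraliser_mult PC QC AC)
  have "leading_coeffs lam A' = Q * C * P"
    unfolding A'_def C_def leading_coeffs_mult[OF pos centraliser_mult[OF QC AC] PC]
      leading_coeffs_mult[OF pos QC AC] leading_coeffs_inflate[OF pos wD(6) cP] leading_coeffs_inflate[OF pos wD(7) cQ] ..
  also have "\<dots> = T" using similar_mat_witD2(3)[OF wD(5) similar_mat_wit_sym[OF w]] ..
  finally have lead: "leading_coeffs lam A' = T" .
  have "A' \<in> triangular_centraliser lam" unfolding triangular_centraliser_def
  proof (intro CollectI conjI A'C allI impI)
    fix i j assume i: "i < ?l" and j: "j \<le> i" and eq: "lam ! i = lam ! j"
    have "A' $$ (enc lam i 0, enc lam j 0) = leading_coeffs lam A' $$ (i,j)"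
      using i j eq by (simp add: leading_coeffs_def)
    thus "A' $$ (enc lam i 0, enc lam j 0) = 0" unfolding lead using T i j by simp
  qed
  moreover have "similar_mat_wit A A' ?P ?Q"
  proof (rule similar_mat_witI[OF PQ QP _ Ac centraliser_carrier[OF A'C] inflate_carrier inflate_carrier])
    note as = assoc_mult_mat[of _ ?n ?n _ ?n _ ?n]
    have QA: "?Q * A \<in> carrier_mat ?n ?n" using mult_carrier_mat[OF inflate_carrier Ac] .
    have "?P * A' = (?P * (?Q * A)) * ?P" unfolding A'_def
      by (rule as[OF inflate_carrier QA inflate_carrier, symmetric])
    also have "?P * (?Q * A) = (?P * ?Q) * A" by (rule as[OF inflate_carrier inflate_carrier Ac, symmetric])
    finally have "?P * A' = A * ?P" using PQ Ac by simp
    hence "?P * A' * ?Q = A * (?P * ?Q)" using as[OF Ac inflate_carrier inflate_carrier, of P Q] by simp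
    thus "A = ?P * A' * ?Q" using PQ Ac by simp
  qed
  ultimately show ?thesis by (rule that)
qed

section \<open>The maximal partition\<close>

lemma triangular_centraliser_line:
  fixes A A' :: "'a :: field mat"
  assumes pos: "\<forall>x\<in>set lam. 0 < x"
    and A: "A \<in> triangular_centraliser lam" and A': "A' \<in> triangular_centraliser lam"
  shows "A + t \<cdot>\<^sub>m (A' - A) \<in> triangular_centraliser lam" (is "?M \<in> _")
proof -
  let ?n = "sum_list lam"
  have C: "A \<in> centraliser lam" "A' \<in> centraliser lam" using assms by (auto simp: triangular_centraliser_def)
  note c = C[THEN centraliser_carrier]
  have M: "?M \<in> carrier_mat ?n ?n" using c by auto
  have e: "?M $$ (p,q) = A $$ (p,q) + t * (A' $$ (p,q) - A $$ (p,q))" if "p < ?n" "q < ?n" for p q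
    using that c by auto
  have "?M \<in> centraliser lam" unfolding centraliser_iff[OF M]
  proof (intro allI impI)
    fix i s j u assume i: "i < length lam" "s < lam ! i" and j: "j < length lam" "u < lam ! j"
    note iff = centraliser_iff[OF c(1), THEN iffD1, OF C(1), rule_format, OF i j]
      centraliser_iff[OF c(2), THEN iffD1, OF C(2), rule_format, OF i j]
    show "(if 0 < u then ?M $$ (enc lam i s, enc lam j (u - 1)) else 0) =
       (if Suc s < lam ! i then ?M $$ (enc lam i (Suc s), enc lam j u) else 0)"
      using iff i j by (auto simp: e enc_less simp del: index_add_mat index_minus_mat split: if_splits)
  qed
  moreover have "?M $$ (enc lam i 0, enc lam j 0) = 0"
    if "i < length lam" "j \<le> i" "lam ! i = lam ! j" for i j
  proof -
    have "0 < lam ! i" "0 < lam ! j" using pos that by auto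
    thus ?thesis using assms that by (simp add: e enc_less triangular_centraliser_def del: index_add_mat index_minus_mat)
  qed
  ultimately show ?thesis by (simp add: triangular_centraliser_def)
qed


definition mat_rank :: "'a :: field mat \<Rightarrow> nat" where
  "mat_rank A = Max {r. rank_at_least A r}"

lemma
  fixes A :: "'a :: field mat"
  assumes "A \<in> carrier_mat n m"
  shows rank_at_least_mat_rank: "rank_at_least A (mat_rank A)"
    and mat_rank_ge: "rank_at_least A r \<Longrightarrow> r \<le> mat_rank A"
proof -
  have fin: "finite {r. rank_at_least A r}"
    by (rule finite_subset[of _ "{..m}"]) (use rank_at_least_le[OF assms] in auto)
  have "0 \<in> {r. rank_at_least A r}" by simp
  hence ne: "{r. rank_at_least A r} \<noteq> {}" by blast
  show "rank_at_least A (mat_rank A)" using Max_in[OF fin ne] by (simp add: mat_rank_def)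
  show "rank_at_least A r \<Longrightarrow> r \<le> mat_rank A" using Max_ge[OF fin] by (simp add: mat_rank_def)
qed

lemma mat_rank_le: "A \<in> carrier_mat n m \<Longrightarrow> mat_rank A \<le> m"
  using rank_at_least_mat_rank rank_at_least_le by blast

lemma triangular_centraliser_carrier:
  "A \<in> triangular_centraliser lam \<Longrightarrow> A \<in> carrier_mat (sum_list lam) (sum_list lam)"
  by (simp add: triangular_centraliser_def centraliser_def)

text \<open>On the line through two matrices every power attains the larger of the two ranks outside
  the zeros of a nonzero polynomial.\<close>

lemma triangular_centraliser_common_rank:
  fixes A A' :: "'a :: field_char_0 mat"
  assumes pos: "\<forall>x\<in>set lam. 0 < x"
    and A: "A \<in> triangular_centraliser lam" and A': "A' \<in> triangular_centraliser lam"
  shows "\<exists>M \<in> triangular_centraliser lam :: 'a mat set. \<forall>j<(N::nat).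
     mat_rank (A ^\<^sub>m j) \<le> mat_rank (M ^\<^sub>m j) \<and> mat_rank (A' ^\<^sub>m j) \<le> mat_rank (M ^\<^sub>m j)"
proof -
  let ?n = "sum_list lam"
  note c = A[THEN triangular_centraliser_carrier] A'[THEN triangular_centraliser_carrier]
  define D where "D = A' - A"
  have D: "D \<in> carrier_mat ?n ?n" using c by (auto simp: D_def)
  have A0: "A + 0 \<cdot>\<^sub>m D = A" and A1: "A + 1 \<cdot>\<^sub>m D = A'"
    using c by (auto simp: D_def intro!: eq_matI)
  have "\<exists>f. f \<noteq> 0 \<and> (\<forall>t. poly f t \<noteq> 0 \<longrightarrow> rank_at_least ((A + t \<cdot>\<^sub>m D) ^\<^sub>m j) (mat_rank (A ^\<^sub>m j)))" for j
    by (rule rank_at_least_generic[OF c(1) D, of 0])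
      (unfold A0, rule rank_at_least_mat_rank[OF pow_carrier_mat[OF c(1)]])
  then obtain f where f: "\<And>j. f j \<noteq> 0"
    "\<And>j t. poly (f j) t \<noteq> 0 \<Longrightarrow> rank_at_least ((A + t \<cdot>\<^sub>m D) ^\<^sub>m j) (mat_rank (A ^\<^sub>m j))" by metis
  have "\<exists>f. f \<noteq> 0 \<and> (\<forall>t. poly f t \<noteq> 0 \<longrightarrow> rank_at_least ((A + t \<cdot>\<^sub>m D) ^\<^sub>m j) (mat_rank (A' ^\<^sub>m j)))" for j
    by (rule rank_at_least_generic[OF c(1) D, of 1])
      (unfold A1, rule rank_at_least_mat_rank[OF pow_carrier_mat[OF c(2)]])
  then obtain g where g: "\<And>j. g j \<noteq> 0"
    "\<And>j t. poly (g j) t \<noteq> 0 \<Longrightarrow> rank_at_least ((A + t \<cdot>\<^sub>m D) ^\<^sub>m j) (mat_rank (A' ^\<^sub>m j))" by metis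
  \<comment> \<open>One polynomial can exclude the bad values of \<open>t\<close> for finitely many
    powers only, hence the bound \<open>N\<close>. All powers from the nilpotency bound on vanish
    anyway.\<close>
  define h where "h = (\<Prod>j<N. f j * g j)"
  have "h \<noteq> 0" using f(1) g(1) by (simp add: h_def)
  hence "finite {t. poly h t = 0}" by (rule poly_roots_finite)
  moreover have "infinite (UNIV :: 'a set)" by (rule infinite_UNIV_char_0)
  ultimately obtain t where t: "poly h t \<noteq> 0" by (metis (mono_tags, lifting) UNIV_eq_I mem_Collect_eq)
  define M where "M = A + t \<cdot>\<^sub>m D"
  have M: "M \<in> triangular_centraliser lam"
    unfolding M_def D_def by (rule triangular_centraliser_line[OF pos A A'])
  have Mj: "M ^\<^sub>m j \<in> carrier_mat ?n ?n" for j using triangular_centraliser_carrier[OF M] by simp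
  have "poly (f j) t \<noteq> 0 \<and> poly (g j) t \<noteq> 0" if "j < N" for j
    using t that by (auto simp: h_def poly_prod)
  hence "mat_rank (A ^\<^sub>m j) \<le> mat_rank (M ^\<^sub>m j) \<and> mat_rank (A' ^\<^sub>m j) \<le> mat_rank (M ^\<^sub>m j)" if "j < N" for j
    using that f(2)[of j t] g(2)[of j t] mat_rank_ge[OF Mj[of j]] unfolding M_def by blast
  thus ?thesis using M by (intro bexI[of _ M]) simp_all
qed

lemma zero_mat_triangular_centraliser:
  assumes pos: "\<forall>x\<in>set lam. 0 < x"
  shows "(0\<^sub>m (sum_list lam) (sum_list lam) :: 'a :: field mat) \<in> triangular_centraliser lam"
  using pos
  by (simp add: triangular_centraliser_def centraliser_def left_mult_zero_mat[OF nil_jordan_carrier]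
     right_mult_zero_mat[OF nil_jordan_carrier] enc_less)

text \<open>Choose \<open>A\<close> with the largest sum of ranks of its powers. If
  \<open>A'\<close> beat it at a single exponent, the point \<open>M\<close> of the line through
  both would be at least as good as \<open>A\<close> everywhere and better there, which increases
  the sum.\<close>

lemma triangular_centraliser_max_rank:
  assumes lam: "sorted_wrt (\<ge>) lam" and pos: "\<forall>x\<in>set lam. 0 < x"
  shows "\<exists>A \<in> triangular_centraliser lam :: 'a :: field_char_0 mat set.
     \<forall>A' \<in> triangular_centraliser lam :: 'a mat set. \<forall>j. mat_rank (A' ^\<^sub>m j) \<le> mat_rank (A ^\<^sub>m j)"
proof -
  let ?n = "sum_list lam"
  define N where "N = sum_list lam * Suc (length lam)"
  define rk where "rk A = (\<Sum>j<N. mat_rank (A ^\<^sub>m j))" for A :: "'a mat"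
  have "\<forall>A. A \<in> triangular_centraliser lam \<longrightarrow> rk A < Suc (N * ?n)"
  proof (intro allI impI)
    fix A :: "'a mat" assume A: "A \<in> triangular_centraliser lam"
    have "mat_rank (A ^\<^sub>m j) \<le> ?n" for j
      by (rule mat_rank_le[OF pow_carrier_mat[OF triangular_centraliser_carrier[OF A]]])
    hence "rk A \<le> (\<Sum>j<N. ?n)" unfolding rk_def by (intro sum_mono)
    thus "rk A < Suc (N * ?n)" by simp
  qed
  from ex_has_greatest_nat[where P = "\<lambda>A. A \<in> triangular_centraliser lam", OF zero_mat_triangular_centraliser[OF pos] this]
  obtain A where A: "A \<in> triangular_centraliser lam"
    and max: "\<And>A'. A' \<in> triangular_centraliser lam \<Longrightarrow> rk A' \<le> rk A" by metis
  have "mat_rank (A' ^\<^sub>m j) \<le> mat_rank (A ^\<^sub>m j)" if A': "A' \<in> triangular_centraliser lam"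
    for A' :: "'a mat" and j
  proof (cases "j < N")
    case True
    from triangular_centraliser_common_rank[OF pos A A', of N]
    obtain M :: "'a mat" where M: "M \<in> triangular_centraliser lam"
      and le': "\<forall>j<N. mat_rank (A ^\<^sub>m j) \<le> mat_rank (M ^\<^sub>m j) \<and> mat_rank (A' ^\<^sub>m j) \<le> mat_rank (M ^\<^sub>m j)"
      by (elim bexE)
    note le = le'[rule_format]
    have "mat_rank (M ^\<^sub>m j) = mat_rank (A ^\<^sub>m j)"
    proof (rule ccontr)
      assume "mat_rank (M ^\<^sub>m j) \<noteq> mat_rank (A ^\<^sub>m j)"
      hence "mat_rank (A ^\<^sub>m j) < mat_rank (M ^\<^sub>m j)" using le[OF True] by simp
      hence "rk A < rk M" unfolding rk_def using le True by (intro sum_strict_mono_ex1) auto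
      thus False using max[OF M] by simp
    qed
    thus ?thesis using le[OF True] by simp
  next
    case False
    have "A' ^\<^sub>m j = A ^\<^sub>m j"
      using False triangular_centraliser_pow_zero[OF lam A, of j] triangular_centraliser_pow_zero[OF lam A', of j]
      by (simp add: N_def)
    thus ?thesis by simp
  qed
  thus ?thesis using A by blast
qed

text \<open>The rank bound makes \<open>mu\<close> the greatest element and not just a maximal one,
  so the description in \<open>D_part\<close> determines it.\<close>

lemma D_part_eqI:
  fixes A :: "'a :: field mat"
  assumes mu: "is_partition (sum_list lam) mu" and A: "A \<in> nil_comm (nil_jordan TYPE('a) lam)" "has_shape A mu"
    and max: "\<And>A' j r. A' \<in> nil_comm (nil_jordan TYPE('a) lam) \<Longrightarrow> rank_at_least (A' ^\<^sub>m j) r \<Longrightarrow> r \<le> pow_rank mu j"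
  shows "D_part TYPE('a) lam = mu"
proof -
  let ?B = "nil_jordan TYPE('a) lam"
  define S where "S = {mu. is_partition (sum_list lam) mu \<and> (\<exists>A\<in>nil_comm ?B. has_shape A mu)}"
  have muS: "mu \<in> S" using mu A by (auto simp: S_def)
  have dom: "dominated nu mu" if nu: "nu \<in> S" for nu
  proof -
    obtain A' where A': "A' \<in> nil_comm ?B" "has_shape A' nu" and p: "is_partition (sum_list lam) nu"
      using nu by (auto simp: S_def)
    have "nilpotent_mat (sum_list lam) A'" using A' by (simp add: nil_comm_conv_centraliser)
    from shape_rank(1)[OF this A'(2)] max[OF A'(1)] have "pow_rank nu j \<le> pow_rank mu j" for j by blast
    thus ?thesis by (rule dominatedI[OF p mu])
  qed
  have "(THE mu. mu \<in> S \<and> (\<forall>nu\<in>S. dominated mu nu \<longrightarrow> nu = mu)) = mu"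
  proof (rule the_equality)
    show "mu \<in> S \<and> (\<forall>nu\<in>S. dominated mu nu \<longrightarrow> nu = mu)"
      using muS dom dominated_antisym mu by (auto simp: S_def)
    fix nu assume "nu \<in> S \<and> (\<forall>rho\<in>S. dominated nu rho \<longrightarrow> rho = nu)"
    thus "nu = mu" using muS dom by auto
  qed
  thus ?thesis unfolding D_part_def Let_def S_def .
qed

text \<open>All that is needed about D(\<lambda>) later: it is the shape of some element of
  \<open>U\<close>, and its rank bounds hold on the whole commutator, since every competitor is
  conjugate into \<open>U\<close>.\<close>

lemma D_part_maximal:
  assumes lam: "sorted_wrt (\<ge>) lam" and pos: "\<forall>x\<in>set lam. 0 < x"
  obtains A :: "'a :: field_char_0 mat" where "A \<in> triangular_centraliser lam"
    "has_shape A (D_part TYPE('a) lam)" "is_partition (sum_list lam) (D_part TYPE('a) lam)"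
    "\<And>A' j r. (A' :: 'a mat) \<in> nil_comm (nil_jordan TYPE('a) lam) \<Longrightarrow> rank_at_least (A' ^\<^sub>m j) r \<Longrightarrow>
       r \<le> pow_rank (D_part TYPE('a) lam) j"
proof -
  obtain A :: "'a mat" where A: "A \<in> triangular_centraliser lam"
    and max: "\<forall>A' \<in> triangular_centraliser lam. \<forall>j. mat_rank (A' ^\<^sub>m j :: 'a mat) \<le> mat_rank (A ^\<^sub>m j)"
    using triangular_centraliser_max_rank[OF lam pos, where 'a = 'a] by (elim bexE)
  have AN: "A \<in> nil_comm (nil_jordan TYPE('a) lam)" by (rule triangular_centraliser_nil_comm[OF lam A])
  hence nil: "nilpotent_mat (sum_list lam) A" by (simp add: nil_comm_conv_centraliser)
  obtain mu where mu: "is_partition (sum_list lam) mu" "has_shape A mu"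
    using nilpotent_shape_exists[OF nil] by blast
  have le: "r \<le> pow_rank mu j"
    if A': "A' \<in> nil_comm (nil_jordan TYPE('a) lam)" and r: "rank_at_least (A' ^\<^sub>m j) r"
    for A' :: "'a mat" and j r
  proof -
    obtain M P Q where M: "M \<in> triangular_centraliser lam" and w: "similar_mat_wit A' M P Q"
      by (rule nil_comm_conjugate_triangular[OF pos A'])
    have c: "M ^\<^sub>m j \<in> carrier_mat (sum_list lam) (sum_list lam)" "A ^\<^sub>m j \<in> carrier_mat (sum_list lam) (sum_list lam)"
      using triangular_centraliser_carrier[OF M] triangular_centraliser_carrier[OF A] by simp_all
    have "rank_at_least (M ^\<^sub>m j) r" using r rank_at_least_similar_iff[OF similar_mat_wit_pow[OF w]] by simp
    hence "r \<le> mat_rank (M ^\<^sub>m j)" by (rule mat_rank_ge[OF c(1)])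
    also have "\<dots> \<le> mat_rank (A ^\<^sub>m j)" using max M by simp
    also have "\<dots> \<le> pow_rank mu j"
      by (rule shape_rank(2)[OF nil mu(2)]) (rule rank_at_least_mat_rank[OF c(2)])
    finally show ?thesis .
  qed
  have "D_part TYPE('a) lam = mu" by (rule D_part_eqI[OF mu(1) AN mu(2) le])
  thus ?thesis using that[OF A] mu le by auto
qed

lemma D_part_rank_le:
  fixes A :: "'a :: field_char_0 mat"
  assumes "sorted_wrt (\<ge>) lam" "\<forall>x\<in>set lam. 0 < x"
    and "A \<in> nil_comm (nil_jordan TYPE('a) lam)" "rank_at_least (A ^\<^sub>m j) r"
  shows "r \<le> pow_rank (D_part TYPE('a) lam) j"
  by (rule D_part_maximal[OF assms(1,2), where 'a = 'a]) (use assms in blast)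

lemma D_part_partition:
  assumes "sorted_wrt (\<ge>) lam" "\<forall>x\<in>set lam. 0 < x"
  shows "is_partition (sum_list lam) (D_part TYPE('a :: field_char_0) lam)"
  by (rule D_part_maximal[OF assms, where 'a = 'a])

section \<open>The staircase as a maximal partition\<close>

definition near_equal :: "nat \<Rightarrow> nat \<Rightarrow> nat \<Rightarrow> nat" where
  "near_equal m t i = (m + t - 1 - i) div t"

text \<open>\<open>near_equal m t i\<close> is the ceiling of \<open>(m - i) / t\<close>.
  Equivalently, deal \<open>0, ..., m - 1\<close> in turn to \<open>t\<close> players; it is the
  number of cards of player \<open>i\<close>, and \<open>s * t + i\<close> is card \<open>s\<close>
  of that player.\<close>

lemma less_near_equal_iff:
  assumes "i < t"
  shows "s < near_equal m t i \<longleftrightarrow> s * t + i < m"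
proof -
  have "s < near_equal m t i \<longleftrightarrow> Suc s \<le> (m + t - 1 - i) div t" by (auto simp: near_equal_def)
  also have "\<dots> \<longleftrightarrow> Suc s * t \<le> m + t - 1 - i" using assms by (simp add: less_eq_div_iff_mult_less_eq)
  also have "\<dots> \<longleftrightarrow> s * t + i < m" using assms by auto
  finally show ?thesis .
qed

lemma bij_betw_near_equal:
  assumes "1 \<le> t"
  shows "bij_betw (\<lambda>(i,s). s * t + i) (SIGMA i:{..<t}. {..<near_equal m t i}) {..<m}"
  by (rule bij_betw_byWitness[of _ "\<lambda>v. (v mod t, v div t)"])
    (use assms in \<open>auto simp: less_near_equal_iff\<close>)

lemma sum_near_equal: "1 \<le> t \<Longrightarrow> (\<Sum>i<t. near_equal m t i) = m"
  using bij_betw_same_card[OF bij_betw_near_equal, of t m] by simp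

text \<open>Parts before position \<open>i\<close> are at most \<open>p ! i + 1\<close> and those
  from \<open>i\<close> on at most \<open>p ! i\<close>; parts up to \<open>i\<close> are at least
  \<open>p ! i\<close> and later ones at least \<open>p ! i - 1\<close>. Summing both estimates
  confines \<open>m\<close> to a range in which the quotient by the length is
  \<open>p ! i\<close>.\<close>

lemma almost_rectangular_nth:
  assumes p: "is_partition m p" and p0: "p \<noteq> []" and hl: "hd p - last p \<le> 1"
    and i: "i < length p"
  shows "p ! i = near_equal m (length p) i"
proof -
  let ?t = "length p"
  have sorted: "p ! b \<le> p ! a" if "a \<le> b" "b < ?t" for a b
    using p that by (cases "a = b") (auto simp: is_partition_def sorted_wrt_iff_nth_less)
  have diff: "p ! a \<le> Suc (p ! b)" if "a < ?t" "b < ?t" for a b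
  proof -
    have "p ! a \<le> hd p" "last p \<le> p ! b"
      using sorted[of 0 a] sorted[of b "?t - 1"] that p0 by (auto simp: hd_conv_nth last_conv_nth)
    thus ?thesis using hl by linarith
  qed
  have m: "m = (\<Sum>j<?t. p ! j)"
    using p by (simp add: is_partition_def sum_list_sum_nth lessThan_atLeast0)
  have t: "{..<?t} = {..<i} \<union> {i..<?t}" "{..<?t} = {..i} \<union> {Suc i..<?t}" using i by auto
  have "m = (\<Sum>j<i. p ! j) + (\<Sum>j\<in>{i..<?t}. p ! j)"
    unfolding m by (subst t(1), rule sum.union_disjoint) auto
  also have "\<dots> \<le> (\<Sum>j<i. Suc (p ! i)) + (\<Sum>j\<in>{i..<?t}. p ! i)"
    by (intro add_mono sum_mono) (use sorted diff i in auto)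
  also have "\<dots> = i + (i + (?t - i)) * p ! i" by (simp add: algebra_simps)
  also have "i + (?t - i) = ?t" using i by simp
  finally have up: "m \<le> i + ?t * p ! i" .
  have "Suc i + (?t - Suc i) = ?t" using i by simp
  hence "?t * p ! i = (Suc i + (?t - Suc i)) * p ! i" by (simp only:)
  also have "\<dots> = (\<Sum>j\<le>i. p ! i) + (\<Sum>j\<in>{Suc i..<?t}. p ! i)" by (simp add: algebra_simps)
  also have "\<dots> \<le> (\<Sum>j\<le>i. p ! j) + (\<Sum>j\<in>{Suc i..<?t}. Suc (p ! j))"
    by (intro add_mono sum_mono) (use sorted diff i in auto)
  also have "\<dots> = (\<Sum>j\<le>i. p ! j) + (\<Sum>j\<in>{Suc i..<?t}. p ! j) + (?t - Suc i)"
    using sum.distrib[of "\<lambda>j. p ! j" "\<lambda>_. 1" "{Suc i..<?t}"] by simp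
  also have "(\<Sum>j\<le>i. p ! j) + (\<Sum>j\<in>{Suc i..<?t}. p ! j) = m"
    unfolding m by (subst t(2), rule sum.union_disjoint[symmetric]) auto
  finally have lo: "?t * p ! i \<le> m + (?t - Suc i)" .
  define x where "x = m + ?t - 1 - i"
  have "?t * p ! i \<le> x" "x < ?t * Suc (p ! i)"
    using lo up i by (auto simp: x_def)
  hence "x div ?t = p ! i" by (metis div_nat_eqI mult.commute)
  thus ?thesis by (simp add: near_equal_def x_def)
qed

lemma r_part_eq:
  assumes t: "1 \<le> t" "t \<le> m"
  shows "r_part m t = map (near_equal m t) [0..<t]"
  unfolding r_part_def
proof (rule the_equality)
  let ?p = "map (near_equal m t) [0..<t]"
  have mono: "near_equal m t b \<le> near_equal m t a" if "a \<le> b" for a b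
    unfolding near_equal_def by (rule div_le_mono) (use that in simp)
  have "near_equal m t 0 \<le> Suc (near_equal m t (t - 1))"
  proof -
    have "near_equal m t 0 \<le> (m + t) div t" unfolding near_equal_def by (rule div_le_mono) simp
    also have "\<dots> = Suc (near_equal m t (t - 1))" using t by (simp add: near_equal_def)
    finally show ?thesis .
  qed
  moreover have "?p \<noteq> []" using t by simp
  hence "hd ?p = near_equal m t 0" "last ?p = near_equal m t (t - 1)"
    using t by (auto simp: hd_conv_nth last_conv_nth simp del: upt_Suc)
  moreover have "sum_list ?p = m"
    using sum_near_equal[OF t(1), of m] by (simp add: sum_list_sum_nth lessThan_atLeast0 del: upt_Suc)
  moreover have "sorted_wrt (\<ge>) ?p" using mono by (auto simp: sorted_wrt_iff_nth_less)
  moreover have "\<forall>x\<in>set ?p. 0 < x" using t less_near_equal_iff[of _ t 0 m] by auto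
  ultimately show "is_partition m ?p \<and> length ?p = t \<and> hd ?p - last ?p \<le> 1"
    by (simp add: is_partition_def)
  fix p assume p: "is_partition m p \<and> length p = t \<and> hd p - last p \<le> 1"
  moreover from p t have "p \<noteq> []" by auto
  ultimately show "p = ?p"
    by (intro nth_equalityI) (use almost_rectangular_nth[of m p] in auto)
qed

lemma sum_list_map_upt: "sum_list (map f [0..<n]) = (\<Sum>i<n. f i)" for f :: "nat \<Rightarrow> nat"
  by (simp add: sum_list_sum_nth lessThan_atLeast0 del: upt_Suc)

section \<open>Weaving the last blocks into one string, and the grading\<close>

locale staircase =
  fixes mu k t :: nat
  assumes mu: "2 * k + 1 \<le> mu" and t: "1 \<le> t" "t \<le> mu - 2 * k"
begin

abbreviation "m \<equiv> mu - 2 * k"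
definition "lam = map (\<lambda>i. mu - 2 * i) [0..<k] @ map (near_equal m t) [0..<t]"
definition "stairs = map (\<lambda>i. mu - 2 * i) [0..<Suc k]"

text \<open>All rows from \<open>k\<close> on share string \<open>k\<close>, on which their basis
  vectors are interleaved as in dealing cards: position \<open>s\<close> of row \<open>i\<close>
  gets depth \<open>s * t + (i - k)\<close>. The strings then have the lengths of the
  staircase.\<close>

definition "string i = min i k"
definition "depth i s = (if i < k then s else s * t + (i - k))"
definition "len i = mu - 2 * i"

lemma length_lam: "length lam = k + t" by (simp add: lam_def)

lemma lam_nth: "i < k \<Longrightarrow> lam ! i = mu - 2 * i" "i < t \<Longrightarrow> lam ! (k + i) = near_equal m t i"
  by (simp_all add: lam_def nth_append)

lemma near_equal_le: "i < t \<Longrightarrow> near_equal m t i \<le> m"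
proof (rule ccontr)
  assume "i < t" "\<not> near_equal m t i \<le> m"
  hence "m * t + i < m" using less_near_equal_iff[of i t m m] by auto
  moreover have "m * 1 \<le> m * t" by (rule mult_le_mono2) (rule t)
  ultimately show False by simp
qed

lemma lam_sorted: "sorted_wrt (\<ge>) lam"
proof -
  have "near_equal m t b \<le> near_equal m t a" if "a \<le> b" for a b
    unfolding near_equal_def by (rule div_le_mono) (use that in simp)
  moreover have "near_equal m t b \<le> mu - 2 * a" if "a < k" "b < t" for a b
    using near_equal_le[OF that(2)] that(1) by linarith
  moreover have "sorted_wrt (\<ge>) (map (\<lambda>i. mu - 2 * i) [0..<k])"
    by (auto simp: sorted_wrt_iff_nth_less)
  moreover have "sorted_wrt (\<ge>) (map (near_equal m t) [0..<t])"
    using calculation(1) by (auto simp: sorted_wrt_iff_nth_less)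
  ultimately show ?thesis unfolding lam_def sorted_wrt_append by auto
qed

lemma lam_pos: "\<forall>x\<in>set lam. 0 < x"
  using mu t less_near_equal_iff[of _ t 0 m] by (auto simp: lam_def)

lemma sum_stairs: "sum_list stairs = (\<Sum>i<Suc k. len i)"
  unfolding stairs_def len_def by (rule sum_list_map_upt)

lemma sum_lam: "sum_list lam = (\<Sum>i<Suc k. len i)"
  unfolding lam_def sum_list_append sum_list_map_upt using sum_near_equal[OF t(1), of m] by (simp add: len_def)

lemma stairs_partition: "is_partition (sum_list lam) stairs"
  using mu unfolding is_partition_def sum_lam sum_stairs[symmetric]
  by (auto simp: stairs_def sorted_wrt_iff_nth_less simp del: upt_Suc)

lemma pow_rank_stairs: "pow_rank stairs j = (\<Sum>i<Suc k. len i - j)"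
  unfolding pow_rank_def stairs_def len_def map_map o_def by (rule sum_list_map_upt)

lemma bij_strings:
  "bij_betw (\<lambda>(i,s). (string i, depth i s)) (SIGMA i:{..<k + t}. {..<lam ! i}) (SIGMA i:{..<Suc k}. {..<len i})"
proof (rule bij_betw_byWitness[of _ "\<lambda>(i,v). if i < k then (i,v) else (k + v mod t, v div t)"])
  have tail: "s < lam ! i \<longleftrightarrow> s * t + (i - k) < m" if "\<not> i < k" "i < k + t" for i s
    using lam_nth(2)[of "i - k"] less_near_equal_iff[of "i - k" t s m] that by simp
  have inv: "k + (s * t + (i - k)) mod t = i" "(s * t + (i - k)) div t = s" if "\<not> i < k" "i < k + t" for i s
    using that by (simp_all add: mod_less div_less del: add_diff_assoc)
  show "\<forall>a\<in>SIGMA i:{..<k + t}. {..<lam ! i}. (case (case a of (i, s) \<Rightarrow> (string i, depth i s)) of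
      (i,v) \<Rightarrow> if i < k then (i,v) else (k + v mod t, v div t)) = a"
    using inv by (auto simp: string_def depth_def min_def simp del: add_diff_assoc)
  show "\<forall>a\<in>SIGMA i:{..<Suc k}. {..<len i}. (case (case a of (i,v) \<Rightarrow> if i < k then (i,v) else (k + v mod t, v div t)) of
      (i,s) \<Rightarrow> (string i, depth i s)) = a"
    using t by (auto simp: string_def depth_def less_Suc_eq)
  show "(\<lambda>(i,s). (string i, depth i s)) ` (SIGMA i:{..<k + t}. {..<lam ! i}) \<subseteq> (SIGMA i:{..<Suc k}. {..<len i})"
    using tail lam_nth(1) by (auto simp: string_def depth_def len_def min_def)
  show "(\<lambda>(i,v). if i < k then (i,v) else (k + v mod t, v div t)) ` (SIGMA i:{..<Suc k}. {..<len i}) \<subseteq>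
      (SIGMA i:{..<k + t}. {..<lam ! i})"
    using t lam_nth(1) by (auto simp: len_def tail less_Suc_eq)
qed

sublocale strings "sum_list lam" "Suc k" "\<lambda>p. string (row_of lam p)" "\<lambda>p. depth (row_of lam p) (off_of lam p)" len
proof
  from bij_betw_trans[OF bij_betw_pos[of lam, unfolded length_lam] bij_strings]
  show "bij_betw (\<lambda>p. (string (row_of lam p), depth (row_of lam p) (off_of lam p))) {..<sum_list lam}
     (SIGMA i:{..<Suc k}. {..<len i})" by (simp add: o_def case_prod_beta)
qed

text \<open>One step inside an interleaved block is \<open>t\<close> steps on the common string. So
  the Jordan matrix is itself a shift along the strings of the staircase, and shifts along the same
  strings commute.\<close>

lemma nil_jordan_S: "nil_jordan T lam = S (\<lambda>i. if i < k then 1 else t)"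
proof -
  have "row_of lam p = row_of lam q \<and> off_of lam q = off_of lam p + 1 \<longleftrightarrow>
    string (row_of lam p) = string (row_of lam q) \<and> depth (row_of lam q) (off_of lam q) =
      depth (row_of lam p) (off_of lam p) + (if string (row_of lam p) < k then 1 else t)" (is "?L \<longleftrightarrow> ?R")
    if pq: "p < sum_list lam" "q < sum_list lam" for p q
  proof -
    let ?i = "row_of lam p" and ?s = "off_of lam p" and ?j = "row_of lam q" and ?u = "off_of lam q"
    have b: "?i < k + t" "?j < k + t" using row_less[OF pq(1)] row_less[OF pq(2)] length_lam by auto
    show ?thesis
    proof (cases "?i < k \<or> ?j < k")
      case True
      thus ?thesis by (auto simp: string_def depth_def min_def)
    next
      case False
      have "?u * t + (?j - k) = Suc ?s * t + (?i - k) \<longleftrightarrow> ?u = Suc ?s \<and> ?j - k = ?i - k"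
      proof
        assume *: "?u * t + (?j - k) = Suc ?s * t + (?i - k)"
        have lt: "?j - k < t" "?i - k < t" using b False t by auto
        have "(?u * t + (?j - k)) div t = ?u" "(Suc ?s * t + (?i - k)) div t = Suc ?s"
          using lt by (simp_all del: mult_Suc)
        thus "?u = Suc ?s \<and> ?j - k = ?i - k" using * by simp
      qed simp
      thus ?thesis using False by (auto simp: string_def depth_def min_def)
    qed
  qed
  thus ?thesis unfolding nil_jordan_shift shift_mat_def by (intro eq_matI) auto
qed

lemma shift_nil_comm: "(S (\<lambda>_. 1) :: 'a :: field mat) \<in> nil_comm (nil_jordan TYPE('a) lam)"
proof -
  \<comment> \<open>The longest string, string 0, has length \<open>mu\<close>.\<close>
  have "S (\<lambda>_. 1) ^\<^sub>m mu = (0\<^sub>m (sum_list lam) (sum_list lam) :: 'a mat)"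
    unfolding shift_pow
  proof (rule eq_matI)
    fix p q assume "p < dim_row (0\<^sub>m (sum_list lam) (sum_list lam) :: 'a mat)" "q < dim_col (0\<^sub>m (sum_list lam) (sum_list lam) :: 'a mat)"
    hence pq: "p < sum_list lam" "q < sum_list lam" by auto
    thus "S (\<lambda>i. mu * 1) $$ (p,q) = (0\<^sub>m (sum_list lam) (sum_list lam) :: 'a mat) $$ (p,q)"
      using lev_less[OF pq(2)] by (auto simp: shift_index len_def)
  qed (auto simp: shift_mat_def)
  hence "nilpotent_mat (sum_list lam) (S (\<lambda>_. 1) :: 'a mat)"
    unfolding nilpotent_mat_def using shift_carrier by blast
  moreover have "(S (\<lambda>_. 1) :: 'a mat) \<in> centraliser lam"
    by (simp add: centraliser_def nil_jordan_S shift_mult add.commute)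
  ultimately show ?thesis by (simp add: nil_comm_conv_centraliser)
qed

text \<open>String \<open>i\<close> occupies the levels \<open>i, ..., mu - 1 - i\<close>, so all
  strings are centred at the same level. This is what lets a single window of levels meet every
  string in as many indices as possible.\<close>

abbreviation "height i s \<equiv> string i + depth i s"

lemma height_raises:
  assumes ij: "i < length lam" "s < lam ! i" "j < length lam" "u < lam ! j"
    and le: "s + min_shift lam i j \<le> u"
  shows "height i s < height j u"
proof (cases "i < k")
  case i: True
  show ?thesis
  proof (cases "j < k")
    case True
    thus ?thesis using i le lam_nth(1)[of i] lam_nth(1)[of j] mu
      by (auto simp: min_shift_def string_def depth_def split: if_splits)
  next
    case False
    have "u * 1 \<le> u * t" by (rule mult_le_mono2) (rule t)
    moreover have "height i s = i + s" "height j u = k + (u * t + (j - k))"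
      using False i by (simp_all add: string_def depth_def)
    moreover have "s \<le> u" using False i le by (simp add: min_shift_def)
    ultimately show ?thesis using False i by linarith
  qed
next
  case i: False
  define i' where "i' = i - k"
  have i': "i = k + i'" "i' < t" using i ij length_lam by (auto simp: i'_def)
  have s: "s < near_equal m t i'" using ij lam_nth(2)[OF i'(2)] i' by simp
  show ?thesis
  proof (cases "j < k")
    case True
    define r where "r = near_equal m t i'"
    have r: "lam ! i = r" "lam ! j = mu - 2 * j" "s < r" using i' lam_nth True s by (auto simp: r_def)
    \<comment> \<open>The move goes from the woven rows back to a longer row. The last position
      \<open>r - 1\<close> of the block has depth below \<open>m\<close>, and each of the
      \<open>r - 1 - s\<close> positions up to it costs \<open>t\<close>, hence at least 1, in
      depth. The prescribed shift makes up for precisely this distance.\<close>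
    have "(r - 1) * t + i' < m" using less_near_equal_iff[OF i'(2), of "r - 1" m] r(3) by (auto simp: r_def)
    moreover have "s * t + (r - 1 - s) * 1 \<le> s * t + (r - 1 - s) * t"
      by (intro add_left_mono mult_le_mono2) (rule t)
    moreover have "s * t + (r - 1 - s) * t = (r - 1) * t"
      using r(3) by (simp flip: add_mult_distrib)
    ultimately have "s * t + i' + (r - 1 - s) < m" by linarith
    moreover have "s + (mu - 2 * j - r) \<le> u" using le True i' r by (auto simp: min_shift_def)
    ultimately show ?thesis using True i' r(3) mu by (simp add: string_def depth_def)
  next
    case False
    define j' where "j' = j - k"
    have j': "j = k + j'" "j' < t" using False ij length_lam by (auto simp: j'_def)
    have h: "height i s = k + (s * t + i')" "height j u = k + (u * t + j')"
      using i' j' by (simp_all add: string_def depth_def)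
    show ?thesis
    proof (cases "i' < j'")
      case True
      hence "s * t \<le> u * t" using le by (intro mult_le_mono1) simp
      thus ?thesis using True unfolding h by linarith
    next
      case False
      hence "Suc s \<le> u" using le i' j' by (simp add: min_shift_def)
      hence "Suc s * t \<le> u * t" by (rule mult_le_mono1)
      thus ?thesis using i' unfolding h mult_Suc by linarith
    qed
  qed
qed

text \<open>The \<open>j\<close>-th power of a matrix that raises levels has corank at least the number of indices in
  any \<open>j\<close> consecutive levels; the middle ones \<open>c, \<dots>, c + j - 1\<close> with \<open>c = (mu - j) div 2\<close> are optimal.\<close>

lemma window_card:
  assumes "i \<le> k"
  shows "min j (len i) \<le> card {v. v < len i \<and> (mu - j) div 2 \<le> i + v \<and> i + v < (mu - j) div 2 + j}"
proof (cases "j \<le> len i")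
  case True
  have "{(mu - j) div 2 - i ..< (mu - j) div 2 - i + j} \<subseteq>
      {v. v < len i \<and> (mu - j) div 2 \<le> i + v \<and> i + v < (mu - j) div 2 + j}"
    using True assms mu by (auto simp: len_def)
  from card_mono[OF _ this] show ?thesis using True by simp
next
  case False
  have "{..<len i} \<subseteq> {v. v < len i \<and> (mu - j) div 2 \<le> i + v \<and> i + v < (mu - j) div 2 + j}"
    using False assms mu by (auto simp: len_def)
  from card_mono[OF _ this] show ?thesis using False by simp
qed

lemma nil_comm_rank_le:
  fixes A :: "'a :: field mat"
  assumes A: "A \<in> nil_comm (nil_jordan TYPE('a) lam)" and rank: "rank_at_least (A ^\<^sub>m j) r"
  shows "r \<le> pow_rank stairs j"
proof -
  let ?n = "sum_list lam"
  obtain M P Q where M: "M \<in> triangular_centraliser lam" and w: "similar_mat_wit A M P Q"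
    by (rule nil_comm_conjugate_triangular[OF lam_pos A])
  have Mc: "M \<in> carrier_mat ?n ?n" by (rule triangular_centraliser_carrier[OF M])
  have rM: "rank_at_least (M ^\<^sub>m j) r" using rank rank_at_least_similar_iff[OF similar_mat_wit_pow[OF w]] by simp
  define c where "c = (mu - j) div 2"
  define h where "h p = height (row_of lam p) (off_of lam p)" for p
  \<comment> \<open>Rows of the \<open>j\<close>-th power at level at least \<open>c\<close> have
    their entries at levels at least \<open>c + j\<close>; the difference of the two index sets is
    the window \<open>W\<close>.\<close>
  define P' where "P' = {p. p < ?n \<and> c \<le> h p}"
  define Q' where "Q' = {p. p < ?n \<and> c + j \<le> h p}"
  define W where "W = {p. p < ?n \<and> c \<le> h p \<and> h p < c + j}"
  have "r + card P' \<le> ?n + card Q'"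
  proof (rule rank_at_least_zero_pattern[OF pow_carrier_mat[OF Mc] _ _ _ rM])
    fix p q assume p: "p \<in> P'" and q: "q < ?n" "q \<notin> Q'"
    hence pn: "p < ?n" by (simp add: P'_def)
    have "h p + j \<le> h q" if "(M ^\<^sub>m j) $$ (p,q) \<noteq> 0"
    proof (rule raising_pow_entry[OF Mc _ pn q(1) that])
      fix p q assume "p < ?n" "q < ?n" "M $$ (p,q) \<noteq> 0"
      thus "h p < h q" unfolding h_def
        by (rule triangular_centraliser_raises[OF lam_sorted M, where h = height]) (rule height_raises)
    qed
    thus "(M ^\<^sub>m j) $$ (p,q) = 0" using p q by (fastforce simp: P'_def Q'_def)
  qed (auto simp: P'_def Q'_def)
  moreover have "card P' = card Q' + card W"
    by (subst card_Un_disjoint[symmetric]) (auto simp: P'_def Q'_def W_def intro!: arg_cong[of _ _ card])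
  ultimately have "r + card W \<le> ?n" by simp
  moreover have "card W = (\<Sum>i<Suc k. card {v. v < len i \<and> c \<le> i + v \<and> i + v < c + j})"
    unfolding W_def h_def by (rule card_indices[of "\<lambda>i v. c \<le> i + v \<and> i + v < c + j"])
  moreover have "(\<Sum>i<Suc k. min j (len i)) \<le> \<dots>"
    unfolding c_def by (intro sum_mono window_card) simp
  moreover have "?n = (\<Sum>i<Suc k. len i - j) + (\<Sum>i<Suc k. min j (len i))"
    unfolding sum_lam sum.distrib[symmetric] by (rule sum.cong) auto
  ultimately show ?thesis unfolding pow_rank_stairs by linarith
qed

text \<open>The unit shift attains the rank bound for all powers at once, so its shape can only be
  the staircase, and the same bound makes this shape the maximum.\<close>

lemma D_part_stairs: "D_part TYPE('a :: field) lam = stairs"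
proof -
  let ?A = "S (\<lambda>_. 1) :: 'a mat"
  have nil: "nilpotent_mat (sum_list lam) ?A" using shift_nil_comm[where 'a = 'a] by (simp add: nil_comm_conv_centraliser)
  obtain nu where nu: "is_partition (sum_list lam) nu" "has_shape ?A nu"
    using nilpotent_shape_exists[OF nil] by blast
  have "pow_rank nu j \<le> pow_rank stairs j" for j
    by (rule nil_comm_rank_le[OF shift_nil_comm shape_rank(1)[OF nil nu(2)]])
  moreover have "pow_rank stairs j \<le> pow_rank nu j" for j
    by (rule shape_rank(2)[OF nil nu(2)]) (use shift_rank[of "\<lambda>_. j"] in \<open>simp add: shift_pow pow_rank_stairs\<close>)
  ultimately have "nu = stairs"
    by (intro dominated_antisym[OF nu(1) stairs_partition] dominatedI[OF nu(1) stairs_partition]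
      dominatedI[OF stairs_partition nu(1)])
  hence "has_shape ?A stairs" using nu(2) by simp
  thus ?thesis by (rule D_part_eqI[OF stairs_partition shift_nil_comm]) (rule nil_comm_rank_le)
qed

end

section \<open>Partitions with a staircase as maximal partition\<close>

text \<open>Ordered by \<open>h\<close>, the elements of \<open>X\<close> form a walk, because any
  two are joined and edges raise \<open>h\<close>. Over the naturals the other walks cannot cancel
  it. The end of the walk is kept at the maximum of \<open>h\<close>, so that it can be
  prolonged.\<close>

lemma chain_walk:
  fixes N :: "nat mat" and h :: "nat \<Rightarrow> nat"
  assumes N: "N \<in> carrier_mat n n"
    and raise: "\<And>p q. p < n \<Longrightarrow> q < n \<Longrightarrow> 0 < N $$ (p,q) \<Longrightarrow> h p < h q"
  shows "X \<subseteq> {..<n} \<Longrightarrow> card X = Suc k \<Longrightarrow>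
    (\<And>p q. p \<in> X \<Longrightarrow> q \<in> X \<Longrightarrow> p \<noteq> q \<Longrightarrow> 0 < N $$ (p,q) \<or> 0 < N $$ (q,p)) \<Longrightarrow>
    \<exists>p<n. \<exists>q\<in>X. (\<forall>r\<in>X. h r \<le> h q) \<and> 0 < (N ^\<^sub>m k) $$ (p,q)"
proof (induction k arbitrary: X)
  case 0
  then obtain x where "X = {x}" by (auto simp: card_1_singleton_iff)
  thus ?case using 0 N by (intro exI[of _ x]) auto
next
  case (Suc k)
  have fin: "finite X" using Suc.prems(1) finite_subset by blast
  have "X \<noteq> {}" using Suc.prems(2) by auto
  hence "Max (h ` X) \<in> h ` X" using fin by (intro Max_in) auto
  then obtain q where "q \<in> X" "Max (h ` X) = h q" by auto
  hence q: "q \<in> X" "\<forall>r\<in>X. h r \<le> h q" using fin Max_ge[of "h ` X"] by auto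
  have "card (X - {q}) = Suc k" using q Suc.prems(2) fin by simp
  moreover have "X - {q} \<subseteq> {..<n}" using Suc.prems(1) by auto
  ultimately have "\<exists>p<n. \<exists>q'\<in>X - {q}. (\<forall>r\<in>X - {q}. h r \<le> h q') \<and> 0 < (N ^\<^sub>m k) $$ (p,q')"
    by (intro Suc.IH) (use Suc.prems(3) in auto)
  then obtain p q' where p: "p < n" and q': "q' \<in> X" "q' \<noteq> q" "0 < (N ^\<^sub>m k) $$ (p,q')" by auto
  have lt: "q < n" "q' < n" using q q' Suc.prems(1) by auto
  have "0 < N $$ (q',q)"
  proof (rule ccontr)
    assume "\<not> 0 < N $$ (q',q)"
    hence "0 < N $$ (q,q')" using Suc.prems(3)[OF q'(1) q(1) q'(2)] by simp
    thus False using raise[OF lt] q(2) q'(1) by fastforce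
  qed
  have Nk: "N ^\<^sub>m k \<in> carrier_mat n n" using N by simp
  have "0 < (N ^\<^sub>m k) $$ (p,q') * N $$ (q',q)" using q' \<open>0 < N $$ (q',q)\<close> by simp
  also have "\<dots> \<le> (\<Sum>r<n. (N ^\<^sub>m k) $$ (p,r) * N $$ (r,q))"
    by (rule member_le_sum) (use lt in auto)
  also have "\<dots> = (N ^\<^sub>m Suc k) $$ (p,q)" using index_mult_mat_sum[OF Nk N p lt(1)] by simp
  finally show ?case using p q by blast
qed

text \<open>The element of \<open>U\<close> with a 1 at every permitted place. It is polymorphic so
  that walks can be counted over the naturals and the count then mapped to the field.\<close>

definition incidence_mat :: "nat list \<Rightarrow> 'a :: zero_neq_one mat" where
  "incidence_mat lam = mat (sum_list lam) (sum_list lam) (\<lambda>(p,q).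
     if off_of lam p + min_shift lam (row_of lam p) (row_of lam q) \<le> off_of lam q then 1 else 0)"

lemma incidence_mat_triangular_centraliser:
  assumes lam: "sorted_wrt (\<ge>) lam" and pos: "\<forall>x\<in>set lam. 0 < x"
  shows "(incidence_mat lam :: 'a :: field mat) \<in> triangular_centraliser lam"
proof -
  have c: "(incidence_mat lam :: 'a mat) \<in> carrier_mat (sum_list lam) (sum_list lam)"
    by (simp add: incidence_mat_def)
  have e: "(incidence_mat lam :: 'a mat) $$ (enc lam i s, enc lam j t) = (if s + min_shift lam i j \<le> t then 1 else 0)"
    if "i < length lam" "s < lam ! i" "j < length lam" "t < lam ! j" for i s j t
    using that by (simp add: incidence_mat_def enc_less pos_enc)
  have "(incidence_mat lam :: 'a mat) \<in> centraliser lam"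
    unfolding centraliser_iff[OF c]
  proof (intro allI impI)
    fix i s j t assume i: "i < length lam" "s < lam ! i" and j: "j < length lam" "t < lam ! j"
    have le: "lam ! j \<le> lam ! i + min_shift lam i j"
      using lam i j by (auto simp: min_shift_def sorted_wrt_iff_nth_less)
    show "(if 0 < t then (incidence_mat lam :: 'a mat) $$ (enc lam i s, enc lam j (t - 1)) else 0) =
      (if Suc s < lam ! i then (incidence_mat lam :: 'a mat) $$ (enc lam i (Suc s), enc lam j t) else 0)"
      using i j le by (auto simp: e)
  qed
  moreover have "(incidence_mat lam :: 'a mat) $$ (enc lam i 0, enc lam j 0) = 0"
    if "i < length lam" "j \<le> i" for i j
    using that pos by (subst e) (auto simp: min_shift_def)
  ultimately show ?thesis by (simp add: triangular_centraliser_def)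
qed

text \<open>Entries of powers of the incidence matrix count walks, hence do not vanish in
  characteristic 0 along a chain.\<close>

lemma incidence_mat_pow_nonzero:
  assumes X: "X \<subseteq> {..<sum_list lam}" "card X = Suc k"
    and chain: "\<And>p q. p \<in> X \<Longrightarrow> q \<in> X \<Longrightarrow> p \<noteq> q \<Longrightarrow>
      off_of lam p + min_shift lam (row_of lam p) (row_of lam q) \<le> off_of lam q \<or>
      off_of lam q + min_shift lam (row_of lam q) (row_of lam p) \<le> off_of lam p"
  shows "\<exists>p<sum_list lam. \<exists>q<sum_list lam. (incidence_mat lam ^\<^sub>m k :: 'a :: field_char_0 mat) $$ (p,q) \<noteq> 0"
proof -
  let ?n = "sum_list lam" and ?N = "incidence_mat lam :: nat mat"
  have N: "?N \<in> carrier_mat ?n ?n" by (simp add: incidence_mat_def)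
  have e: "0 < ?N $$ (p,q) \<longleftrightarrow> off_of lam p + min_shift lam (row_of lam p) (row_of lam q) \<le> off_of lam q"
    if "p < ?n" "q < ?n" for p q using that by (simp add: incidence_mat_def)
  have "\<exists>p<?n. \<exists>q\<in>X. (\<forall>r\<in>X. off_of lam r * Suc (length lam) + row_of lam r \<le>
      off_of lam q * Suc (length lam) + row_of lam q) \<and> 0 < (?N ^\<^sub>m k) $$ (p,q)"
  proof (rule chain_walk[OF N _ X])
    fix p q assume "p < ?n" "q < ?n" "0 < ?N $$ (p,q)"
    thus "off_of lam p * Suc (length lam) + row_of lam p < off_of lam q * Suc (length lam) + row_of lam q"
      using min_shift_level[OF row_less row_less, of p lam q] e by simp
  next
    fix p q assume pq: "p \<in> X" "q \<in> X" "p \<noteq> q"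
    hence "p < ?n" "q < ?n" using X by auto
    thus "0 < ?N $$ (p,q) \<or> 0 < ?N $$ (q,p)" using chain[OF pq] e by simp
  qed
  then obtain p q where pq: "p < ?n" "q \<in> X" "0 < (?N ^\<^sub>m k) $$ (p,q)" by blast
  have q: "q < ?n" using pq X by auto
  have "incidence_mat lam = map_mat (of_nat :: nat \<Rightarrow> 'a) ?N"
    by (rule eq_matI) (auto simp: incidence_mat_def)
  moreover have hom: "semiring_hom (of_nat :: nat \<Rightarrow> 'a)" by unfold_locales auto
  ultimately have "(incidence_mat lam ^\<^sub>m k :: 'a mat) = map_mat of_nat (?N ^\<^sub>m k)"
    using semiring_hom.mat_hom_pow[OF hom N, of k] by simp
  hence "(incidence_mat lam ^\<^sub>m k :: 'a mat) $$ (p,q) = of_nat ((?N ^\<^sub>m k) $$ (p,q))"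
    using pq(1) q by (simp add: carrier_matD[OF N])
  thus ?thesis using pq q by (metis of_nat_0_eq_iff less_numeral_extra(3))
qed

definition chain_weight :: "nat \<Rightarrow> nat \<Rightarrow> nat" where
  "chain_weight a x = (if Suc a < x then 2 else if a \<le> x then x else 0)"

text \<open>Both ends of every part above \<open>a + 1\<close> together with all of the parts \<open>a\<close> and \<open>a + 1\<close>
  form a chain.\<close>

lemma D_part_chain:
  assumes lam: "sorted_wrt (\<ge>) lam" and pos: "\<forall>x\<in>set lam. 0 < x" and a: "Suc a \<in> set lam"
  shows "\<exists>x\<in>set (D_part TYPE('a :: field_char_0) lam). sum_list (map (chain_weight a) lam) \<le> x"
proof -
  let ?n = "sum_list lam"
  interpret strings ?n "length lam" "row_of lam" "off_of lam" "\<lambda>i. lam ! i" by (rule strings_pos)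
  define G where "G i s \<longleftrightarrow> a \<le> lam ! i \<and> (Suc a < lam ! i \<longrightarrow> s = 0 \<or> s = lam ! i - 1)" for i s
  define X where "X = {p. p < ?n \<and> G (row_of lam p) (off_of lam p)}"
  have row: "card {s. s < lam ! i \<and> G i s} = chain_weight a (lam ! i)" for i
  proof -
    have "{s. s < lam ! i \<and> G i s} = {0, lam ! i - 1}" if "Suc a < lam ! i" using that by (auto simp: G_def)
    moreover have "{s. s < lam ! i \<and> G i s} = {..<lam ! i}" if "\<not> Suc a < lam ! i" "a \<le> lam ! i"
      using that by (auto simp: G_def)
    moreover have "{s. s < lam ! i \<and> G i s} = {}" if "\<not> a \<le> lam ! i" using that by (auto simp: G_def)
    ultimately show ?thesis by (auto simp: chain_weight_def)
  qed
  have cX: "card X = sum_list (map (chain_weight a) lam)"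
    unfolding X_def card_indices row by (simp add: sum_list_sum_nth lessThan_atLeast0)
  have "chain_weight a (Suc a) \<le> sum_list (map (chain_weight a) lam)"
    by (rule member_le_sum_list) (use a in auto)
  then obtain k where k: "card X = Suc k" unfolding cX[symmetric]
    by (cases "card X") (auto simp: chain_weight_def)
  have chain: "s + min_shift lam i j \<le> t \<or> t + min_shift lam j i \<le> s"
    if ij: "i \<le> j" "j < length lam" and st: "s < lam ! i" "t < lam ! j" "G i s" "G j t" "(i,s) \<noteq> (j,t)" for i s j t
  proof (cases "i = j")
    case True
    thus ?thesis using st by (auto simp: min_shift_def)
  next
    case False
    \<comment> \<open>If \<open>s \<le> t\<close>, the move to the later row is permitted. Otherwise
      \<open>t < s\<close>: for lengths differing by at most 1, one step of offset suffices to
      return. For a larger difference row \<open>i\<close> is longer than \<open>a + 1\<close>, so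
      \<open>s\<close> is its last position, which every position of row \<open>j\<close> can
      reach.\<close>
    hence "lam ! j \<le> lam ! i" using lam ij by (simp add: sorted_wrt_iff_nth_less)
    thus ?thesis using False ij st by (auto simp: min_shift_def G_def)
  qed
  have "\<exists>p<?n. \<exists>q<?n. (incidence_mat lam ^\<^sub>m k :: 'a mat) $$ (p,q) \<noteq> 0"
  proof (rule incidence_mat_pow_nonzero[OF _ k])
    fix p q assume "p \<in> X" "q \<in> X" and ne: "p \<noteq> q"
    hence pq: "p < ?n" "q < ?n" "G (row_of lam p) (off_of lam p)" "G (row_of lam q) (off_of lam q)"
      by (auto simp: X_def)
    have ne': "(row_of lam p, off_of lam p) \<noteq> (row_of lam q, off_of lam q)"
      using index_inj[OF pq(1,2)] ne by auto
    show "off_of lam p + min_shift lam (row_of lam p) (row_of lam q) \<le> off_of lam q \<or>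
      off_of lam q + min_shift lam (row_of lam q) (row_of lam p) \<le> off_of lam p"
    proof (cases "row_of lam p \<le> row_of lam q")
      case True
      from chain[OF True row_less[OF pq(2)] off_less[OF pq(1)] off_less[OF pq(2)] pq(3,4) ne'] show ?thesis .
    next
      case False
      hence "row_of lam q \<le> row_of lam p" by simp
      from chain[OF this row_less[OF pq(1)] off_less[OF pq(2)] off_less[OF pq(1)] pq(4,3) ne'[symmetric]]
      show ?thesis by blast
    qed
  qed (auto simp: X_def)
  then obtain p q where pq: "p < ?n" "q < ?n" "(incidence_mat lam ^\<^sub>m k :: 'a mat) $$ (p,q) \<noteq> 0" by blast
  have T: "(incidence_mat lam :: 'a mat) \<in> triangular_centraliser lam"
    by (rule incidence_mat_triangular_centraliser[OF lam pos])
  have "rank_at_least (incidence_mat lam ^\<^sub>m k :: 'a mat) 1"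
    by (rule rank_at_least_1I[OF pow_carrier_mat[OF triangular_centraliser_carrier[OF T]] pq])
  hence "1 \<le> pow_rank (D_part TYPE('a) lam) k"
    by (rule D_part_rank_le[OF lam pos triangular_centraliser_nil_comm[OF lam T]])
  \<comment> \<open>A power with exponent \<open>k\<close> that is not zero requires a part of size
    at least \<open>k + 1\<close>, the size of the chain.\<close>
  hence "sum_list (map (\<lambda>x. x - k) (D_part TYPE('a) lam)) \<noteq> 0"
    unfolding pow_rank_def by linarith
  then obtain x where "x \<in> set (D_part TYPE('a) lam)" "x - k \<noteq> 0" by auto
  thus ?thesis using k cX by (intro bexI[of _ x]) auto
qed

section \<open>A lower bound for the number of parts\<close>

text \<open>The number of parts is the corank of \<open>A\<close>. Cutting each row at offset
  \<open>f\<close> of its length leaves a set \<open>P\<close> whose span is invariant, and the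
  image of this span misses the \<open>card T\<close> indices in \<open>E\<close>, one at the cut of
  a row of each length in \<open>T\<close>. Invariance holds as \<open>f\<close> is monotone and
  grows by at most 1 per unit. Missing \<open>E\<close> needs strictness at lengths in
  \<open>T\<close>, which the gaps of 2 provide.\<close>

lemma D_part_length_ge:
  assumes lam: "sorted_wrt (\<ge>) lam" and pos: "\<forall>x\<in>set lam. 0 < x"
    and T: "T \<subseteq> set lam" and gap: "\<And>x y. x \<in> T \<Longrightarrow> y \<in> T \<Longrightarrow> x < y \<Longrightarrow> x + 2 \<le> y"
  shows "card T \<le> length (D_part TYPE('a :: field_char_0) lam)"
proof -
  let ?n = "sum_list lam"
  obtain A :: "'a mat" where A: "A \<in> triangular_centraliser lam" and sh: "has_shape A (D_part TYPE('a) lam)"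
    and part: "is_partition ?n (D_part TYPE('a) lam)"
    by (rule D_part_maximal[OF lam pos, where 'a = 'a])
  note Ac = triangular_centraliser_carrier[OF A]
  have finT: "finite T" using T finite_subset by blast
  define f where "f v = card {x\<in>T. x < v}" for v
  have f_mono: "f v \<le> f w" if "v \<le> w" for v w
    unfolding f_def by (rule card_mono) (use that finT in auto)
  have f_lip: "f w \<le> f v + (w - v)" for v w
  proof -
    have "f w \<le> card ({x\<in>T. x < v} \<union> {v..<w})"
      unfolding f_def by (rule card_mono) (use finT in auto)
    also have "\<dots> \<le> f v + (w - v)" unfolding f_def by (rule order_trans[OF card_Un_le]) simp
    finally show ?thesis .
  qed
  have f_up: "Suc (f w) \<le> f v" if "w \<in> T" "w < v" for v w
  proof -
    have "Suc (f w) = card (insert w {x\<in>T. x < w})" unfolding f_def using finT by simp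
    also have "\<dots> \<le> f v" unfolding f_def by (rule card_mono) (use that finT in auto)
    finally show ?thesis .
  qed
  have f_down: "f w < f v + (w - v)" if "w \<in> T" "v < w" for v w
  proof -
    \<comment> \<open>By the gap condition \<open>w - 1\<close> is not counted, so \<open>f\<close>
      fails to grow on at least one unit below \<open>w\<close>.\<close>
    have "w - 1 \<notin> T" using gap[of "w - 1" w] that by auto
    hence "{x\<in>T. x < w} \<subseteq> {x\<in>T. x < v} \<union> {v..<w - 1}"
      by (auto simp: nat_less_le)
    hence "f w \<le> card ({x\<in>T. x < v} \<union> {v..<w - 1})" unfolding f_def by (intro card_mono) (use finT in auto)
    also have "\<dots> \<le> f v + (w - 1 - v)" unfolding f_def by (rule order_trans[OF card_Un_le]) simp
    finally show ?thesis using that by linarith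
  qed
  have f_less: "f v < v" if "v \<in> T" for v
  proof -
    have "0 < v" using that T pos by auto
    have "{x\<in>T. x < v} \<subseteq> {1..<v}" using T pos by force
    hence "f v \<le> card {1..<v}" unfolding f_def by (intro card_mono) auto
    thus ?thesis using \<open>0 < v\<close> by simp
  qed
  \<comment> \<open>The topmost row of length \<open>v\<close> is taken, so that every row above it
    is strictly longer; a move down into it then starts at a row with a larger value of
    \<open>f\<close>.\<close>
  define first where "first v = (LEAST i. i < length lam \<and> lam ! i = v)" for v
  have first: "first v < length lam" "lam ! first v = v" if "v \<in> T" for v
    using that T LeastI_ex[of "\<lambda>i. i < length lam \<and> lam ! i = v"] unfolding first_def
    by (auto simp: in_set_conv_nth subset_iff)
  have first_le: "first v \<le> i" if "i < length lam" "lam ! i = v" for i v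
    unfolding first_def by (rule Least_le) (use that in simp)
  define P where "P = {p. p < ?n \<and> f (lam ! row_of lam p) \<le> off_of lam p}"
  define E where "E = (\<lambda>v. enc lam (first v) (f v)) ` T"
  have posE: "pos lam (enc lam (first v) (f v)) = (first v, f v)" if "v \<in> T" for v
    by (rule pos_enc) (use that first f_less in auto)
  have EP: "E \<subseteq> P" using first f_less posE by (auto simp: E_def P_def enc_less)
  have cE: "card E = card T" unfolding E_def
  proof (rule card_image, rule inj_onI)
    fix v w assume vw: "v \<in> T" "w \<in> T" "enc lam (first v) (f v) = enc lam (first w) (f w)"
    hence "first v = first w" using posE[of v] posE[of w] by (metis prod.inject)
    thus "v = w" using first vw by metis
  qed
  have finP: "finite P" by (simp add: P_def)
  have "pow_rank (D_part TYPE('a) lam) 1 + card P \<le> ?n + card (P - E)"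
  proof (rule rank_at_least_zero_pattern[OF Ac])
    show "rank_at_least A (pow_rank (D_part TYPE('a) lam) 1)"
    proof -
      have "nilpotent_mat ?n A"
        using triangular_centraliser_nil_comm[OF lam A] by (simp add: nil_comm_conv_centraliser)
      from shape_rank(1)[OF this sh, of 1] show ?thesis using Ac by simp
    qed
    fix p q assume p: "p \<in> P" and q: "q < ?n" "q \<notin> P - E"
    show "A $$ (p,q) = 0"
    proof (rule ccontr)
      assume nz: "A $$ (p,q) \<noteq> 0"
      define i s j t where "i = row_of lam p" and "s = off_of lam p" and "j = row_of lam q" and "t = off_of lam q"
      have pn: "p < ?n" using p by (simp add: P_def)
      note b = pos_bounds[OF pn, folded i_def s_def] pos_bounds[OF q(1), folded j_def t_def]
      have st: "s + min_shift lam i j \<le> t"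
        by (rule triangular_centraliser_entry[OF lam A]) (use b nz in auto)
      have s: "f (lam ! i) \<le> s" using p by (simp add: P_def i_def s_def)
      have mono: "lam ! j \<le> lam ! i" if "i < j" using lam that b by (simp add: sorted_wrt_iff_nth_less)
      have "f (lam ! j) \<le> f (lam ! i) + min_shift lam i j"
        using f_mono[OF mono] f_lip[of "lam ! j" "lam ! i"] by (auto simp: min_shift_def)
      hence "f (lam ! j) \<le> t" using s st by linarith
      hence "q \<in> P" using q(1) by (simp add: P_def j_def t_def)
      hence "q \<in> E" using q(2) by simp
      then obtain w where w: "w \<in> T" "q = enc lam (first w) (f w)" by (auto simp: E_def)
      hence j: "j = first w" "t = f w" using posE[OF w(1)] by (auto simp: j_def t_def)
      hence jw: "lam ! j = w" using first[OF w(1)] by simp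
      have "f w < f (lam ! i) + min_shift lam i j"
      proof (cases "i < j")
        case True
        hence "lam ! i \<noteq> w" using first_le[of i w] b j by auto
        hence "w < lam ! i" using mono[OF True] jw by simp
        thus ?thesis using f_up[OF w(1)] by fastforce
      next
        case False
        have "w \<le> lam ! i \<or> lam ! i < w" by auto
        thus ?thesis
        proof
          assume "w \<le> lam ! i"
          hence "f w \<le> f (lam ! i)" by (rule f_mono)
          thus ?thesis using False by (simp add: min_shift_def)
        next
          assume "lam ! i < w"
          from f_down[OF w(1) this] show ?thesis using False jw by (simp add: min_shift_def)
        qed
      qed
      thus False using s st j by linarith
    qed
  qed (auto simp: P_def)
  moreover have "card (P - E) + card T = card P"
    using card_Diff_subset[OF finite_subset[OF EP finP] EP] card_mono[OF finP EP] cE by simp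
  moreover have "pow_rank D 1 + length D = sum_list D" if "\<forall>x\<in>set D. 0 < x" for D
    using that by (induction D) (auto simp: pow_rank_def)
  hence "pow_rank (D_part TYPE('a) lam) 1 + length (D_part TYPE('a) lam) = ?n"
    using part by (simp add: is_partition_def)
  ultimately show ?thesis by linarith
qed

section \<open>Recovering the partition from the bounds\<close>

text \<open>One step of the greedy cover. All parts left over differ from \<open>g\<close> by at
  least 2, so \<open>g\<close> extends any gapped set chosen from them.\<close>

lemma sorted_top_split:
  fixes lam :: "nat list"
  assumes lam: "sorted_wrt (\<ge>) lam" and ne: "lam \<noteq> []"
  obtains g hi rest where "lam = hi @ rest" "g \<in> set hi"
    "\<And>x. x \<in> set hi \<Longrightarrow> g \<le> Suc x \<and> x \<le> g" "\<And>x. x \<in> set rest \<Longrightarrow> x + 2 \<le> g"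
proof -
  define g where "g = hd lam"
  let ?P = "\<lambda>x. g \<le> Suc x"
  define hi rest where "hi = takeWhile ?P lam" and "rest = dropWhile ?P lam"
  have eq: "lam = hi @ rest" by (simp add: hi_def rest_def)
  have top: "x \<le> g" if "x \<in> set lam" for x
    using lam ne that unfolding g_def by (cases lam) auto
  have "g \<in> set hi" using ne unfolding g_def hi_def by (cases lam) auto
  moreover have "g \<le> Suc x \<and> x \<le> g" if "x \<in> set hi" for x
  proof -
    have "x \<in> set lam" "?P x" using that unfolding hi_def by (auto dest: set_takeWhileD)
    thus ?thesis using top by simp
  qed
  moreover have "x + 2 \<le> g" if x: "x \<in> set rest" for x
  proof -
    have "rest \<noteq> []" using x by auto
    hence "\<not> ?P (hd rest)" unfolding rest_def by (rule hd_dropWhile)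
    moreover have "sorted_wrt (\<ge>) rest" using lam eq by (metis sorted_wrt_append)
    hence "x \<le> hd rest" using x by (cases rest) auto
    ultimately show ?thesis by linarith
  qed
  ultimately show ?thesis using that eq by blast
qed

text \<open>The hypotheses pass to \<open>rest\<close> with \<open>mu - 2\<close> and one step
  fewer: chains in \<open>rest\<close> extend by two vectors for each part of \<open>hi\<close>,
  gapped sets extend by \<open>g\<close>, and the top chain gives
  \<open>sum_list hi \<le> mu\<close>. The second conclusion, a chain of full weight, strengthens
  the induction: with it the number of parts in \<open>hi\<close> can be bounded.\<close>

lemma staircase_of_bounds:
  assumes "sorted_wrt (\<ge>) lam" "\<forall>x\<in>set lam. 0 < x" "2 * k + 1 \<le> mu"
    and "\<And>a. Suc a \<in> set lam \<Longrightarrow> sum_list (map (chain_weight a) lam) \<le> mu"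
    and "\<And>T. T \<subseteq> set lam \<Longrightarrow> (\<And>x y. x \<in> T \<Longrightarrow> y \<in> T \<Longrightarrow> x < y \<Longrightarrow> x + 2 \<le> y) \<Longrightarrow> card T \<le> Suc k"
    and "(\<Sum>i<Suc k. mu - 2 * i) \<le> sum_list lam"
  shows "(\<exists>t. 1 \<le> t \<and> t \<le> mu - 2 * k \<and>
      lam = map (\<lambda>i. mu - 2 * i) [0..<k] @ map (near_equal (mu - 2 * k) t) [0..<t]) \<and>
    (\<exists>a. Suc a \<in> set lam \<and> mu \<le> sum_list (map (chain_weight a) lam))"
  using assms
proof (induction k arbitrary: mu lam)
  case (0 mu lam)
  note lam = 0(1) and pos = 0(2) and mu = 0(3) and chain = 0(4) and gap = 0(5) and sum = 0(6)
  have ne: "lam \<noteq> []" using sum mu by auto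
  obtain g hi rest where s: "lam = hi @ rest" "g \<in> set hi"
    and hi: "\<And>x. x \<in> set hi \<Longrightarrow> g \<le> Suc x \<and> x \<le> g" and rest: "\<And>x. x \<in> set rest \<Longrightarrow> x + 2 \<le> g"
    using sorted_top_split[OF lam ne] by metis
  have g: "g \<in> set lam" "0 < g" using s pos by auto
  have "rest = []"
  proof (rule ccontr)
    assume "rest \<noteq> []"
    hence r: "hd rest \<in> set rest" by simp
    \<comment> \<open>A part outside the top piece would form a gapped pair with \<open>g\<close>,
      while only one step is allowed.\<close>
    have "card {hd rest, g} \<le> Suc 0"
    proof (rule gap)
      show "{hd rest, g} \<subseteq> set lam" using r g unfolding s(1) by auto
    qed (use rest[OF r] in auto)
    thus False using rest[OF r] by (auto simp: card_insert_if)
  qed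
  hence hl: "\<forall>x\<in>set lam. g \<le> Suc x \<and> x \<le> g" using hi s by simp
  have Sa: "Suc (g - 1) \<in> set lam" using g by simp
  have "map (chain_weight (g - 1)) lam = lam"
    by (rule map_idI) (use hl in \<open>auto simp: chain_weight_def\<close>)
  with chain[OF Sa] sum have eq: "sum_list lam = mu" by simp
  have part: "is_partition mu lam" using lam pos eq by (simp add: is_partition_def)
  have "hd lam \<le> g" "g \<le> Suc (last lam)" using hl ne by auto
  hence "hd lam - last lam \<le> 1" by linarith
  note nth = almost_rectangular_nth[OF part ne this]
  have "length xs \<le> sum_list xs" if "\<forall>x\<in>set xs. 0 < x" for xs :: "nat list"
    using that by (induction xs) auto
  hence "length lam \<le> mu" using pos eq by blast
  moreover have "1 \<le> length lam" using ne by (cases lam) auto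
  moreover have "lam = map (near_equal mu (length lam)) [0..<length lam]"
    by (rule nth_equalityI) (use nth in auto)
  ultimately show ?case
    using Sa \<open>map (chain_weight (g - 1)) lam = lam\<close> eq
    by (intro conjI exI[of _ "length lam"] exI[of _ "g - 1"]) auto
next
  case (Suc k mu lam)
  note lam = Suc.prems(1) and pos = Suc.prems(2) and mu = Suc.prems(3) and chain = Suc.prems(4)
    and gap = Suc.prems(5) and sum = Suc.prems(6)
  have split: "(\<Sum>i<Suc (Suc k). mu - 2 * i) = mu + (\<Sum>i<Suc k. (mu - 2) - 2 * i)"
    unfolding sum.lessThan_Suc_shift[of _ "Suc k"] by (simp add: algebra_simps)
  have ne: "lam \<noteq> []" using sum mu unfolding split by auto
  obtain g hi rest where s: "lam = hi @ rest" "g \<in> set hi"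
    and hi: "\<And>x. x \<in> set hi \<Longrightarrow> g \<le> Suc x \<and> x \<le> g" and rest: "\<And>x. x \<in> set rest \<Longrightarrow> x + 2 \<le> g"
    using sorted_top_split[OF lam ne] by metis
  have g: "g \<in> set lam" "0 < g" using s pos by auto
  have Sa: "Suc (g - 1) \<in> set lam" using g by simp
  have cw_hi: "map (chain_weight (g - 1)) hi = hi"
    by (rule map_idI) (use g in \<open>force simp: chain_weight_def dest: hi\<close>)
  have cw_rest: "sum_list (map (chain_weight (g - 1)) rest) = 0"
  proof -
    have "chain_weight (g - 1) x = 0" if "x \<in> set rest" for x
      using rest[OF that] by (simp add: chain_weight_def)
    thus ?thesis by simp
  qed
  have cw: "sum_list (map (chain_weight (g - 1)) lam) = sum_list hi"
    unfolding s(1) map_append sum_list_append using cw_hi cw_rest by simp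
  have hi_le: "sum_list hi \<le> mu" using chain[OF Sa] cw by simp
  have two: "sum_list (map (chain_weight a) lam) = 2 * length hi + sum_list (map (chain_weight a) rest)"
    if a: "Suc a \<in> set rest" for a
  proof -
    have "sum_list (map (chain_weight a) hi) = sum_list (map (\<lambda>_. 2) hi)"
      \<comment> \<open>From \<open>a + 3 \<le> g\<close> every part of \<open>hi\<close> is at
        least \<open>g - 1\<close>, hence above \<open>a + 1\<close>, and counts with its two
        ends.\<close>
      by (rule arg_cong[of _ _ sum_list], rule map_cong[OF refl]) (use rest[OF a] in \<open>force simp: chain_weight_def dest: hi\<close>)
    thus ?thesis unfolding s(1) by (simp add: sum_list_triv)
  qed
  have len: "1 \<le> length hi" using s(2) by (cases hi) auto
  have IH: "(\<exists>t. 1 \<le> t \<and> t \<le> mu - 2 - 2 * k \<and>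
      rest = map (\<lambda>i. mu - 2 - 2 * i) [0..<k] @ map (near_equal (mu - 2 - 2 * k) t) [0..<t]) \<and>
    (\<exists>a. Suc a \<in> set rest \<and> mu - 2 \<le> sum_list (map (chain_weight a) rest))"
  proof (rule Suc.IH)
    show "sorted_wrt (\<ge>) rest" using lam s(1) by (metis sorted_wrt_append)
    show "\<forall>x\<in>set rest. 0 < x" using pos s(1) by simp
    show "2 * k + 1 \<le> mu - 2" using mu by simp
    show "sum_list (map (chain_weight a) rest) \<le> mu - 2" if "Suc a \<in> set rest" for a
      using two[OF that] chain[of a] that s(1) len by simp
    show "card T \<le> Suc k" if T: "T \<subseteq> set rest" "\<And>x y. x \<in> T \<Longrightarrow> y \<in> T \<Longrightarrow> x < y \<Longrightarrow> x + 2 \<le> y" for T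
    proof -
      have "card (insert g T) \<le> Suc (Suc k)"
      proof (rule gap)
        show "insert g T \<subseteq> set lam" using T g s(1) by auto
        fix x y assume "x \<in> insert g T" "y \<in> insert g T" "x < y"
        thus "x + 2 \<le> y" using T rest by fastforce
      qed
      moreover have "g \<notin> T" using T rest by fastforce
      moreover have "finite T" using T finite_subset by blast
      ultimately show ?thesis by simp
    qed
    show "(\<Sum>i<Suc k. mu - 2 - 2 * i) \<le> sum_list rest"
      using sum hi_le unfolding split s(1) sum_list_append by linarith
  qed
  then obtain t a where t: "1 \<le> t" "t \<le> mu - 2 - 2 * k"
    and r: "rest = map (\<lambda>i. mu - 2 - 2 * i) [0..<k] @ map (near_equal (mu - 2 - 2 * k) t) [0..<t]"
    and a: "Suc a \<in> set rest" "mu - 2 \<le> sum_list (map (chain_weight a) rest)" by blast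
  have "sum_list rest = (\<Sum>i<Suc k. mu - 2 - 2 * i)"
    unfolding r sum_list_append sum_list_map_upt using sum_near_equal[OF t(1)] by simp
  hence hi_sum: "sum_list hi = mu" using sum hi_le unfolding split s(1) sum_list_append by linarith
  \<comment> \<open>The full chain of weight \<open>mu - 2\<close> in \<open>rest\<close> leaves
    room for just two more vectors, that is, for a single part in \<open>hi\<close>.\<close>
  have "2 * length hi + (mu - 2) \<le> mu" using two[OF a(1)] chain[of a] a s(1) by auto
  hence "length hi = 1" using len mu by linarith
  hence "hi = [mu]" using hi_sum by (cases hi) auto
  moreover have "map (\<lambda>i. mu - 2 * i) [0..<Suc k] = mu # map (\<lambda>i. mu - 2 - 2 * i) [0..<k]"
    by (simp add: upt_conv_Cons map_Suc_upt[symmetric] del: upt_Suc)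
  moreover have "mu - 2 - 2 * k = mu - 2 * Suc k" by simp
  ultimately have "lam = map (\<lambda>i. mu - 2 * i) [0..<Suc k] @ map (near_equal (mu - 2 * Suc k) t) [0..<t]"
    using s(1) r by simp
  moreover have "mu \<le> sum_list (map (chain_weight (g - 1)) lam)" using cw hi_sum by simp
  ultimately show ?case using t Sa \<open>mu - 2 - 2 * k = mu - 2 * Suc k\<close> by (metis (no_types, lifting))
qed

theorem theorem4p1:
  fixes mu k :: nat
  assumes "mu \<ge> 2 * k + 1"
  shows "(\<forall>lam. is_partition (sum_list lam) lam \<longrightarrow>
           (D_part TYPE('a :: {alg_closed_field, field_char_0}) lam = map (\<lambda>i. mu - 2 * i) [0..<Suc k]
            \<longleftrightarrow> (\<exists>t\<in>{1..mu - 2 * k}.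
                   lam = map (\<lambda>i. mu - 2 * i) [0..<k] @ r_part (mu - 2 * k) t)))
         \<and> card {lam. is_partition (sum_list (map (\<lambda>i. mu - 2 * i) [0..<Suc k])) lam \<and>
                 D_part TYPE('a) lam = map (\<lambda>i. mu - 2 * i) [0..<Suc k]} = mu - 2 * k"
proof -
  let ?stairs = "map (\<lambda>i. mu - 2 * i) [0..<Suc k]"
  let ?lam = "\<lambda>t. map (\<lambda>i. mu - 2 * i) [0..<k] @ r_part (mu - 2 * k) t"
  have stairs: "is_partition (sum_list ?stairs) (?lam t)" "D_part TYPE('a) (?lam t) = ?stairs" "length (?lam t) = k + t"
    if t: "t \<in> {1..mu - 2 * k}" for t
  proof -
    interpret st: staircase mu k t by unfold_locales (use assms t in auto)
    have eq: "?lam t = st.lam" using t by (simp add: st.lam_def r_part_eq)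
    show "is_partition (sum_list ?stairs) (?lam t)"
      using st.lam_sorted st.lam_pos st.sum_lam st.sum_stairs unfolding eq st.stairs_def[symmetric]
      by (simp add: is_partition_def)
    show "D_part TYPE('a) (?lam t) = ?stairs" unfolding eq st.D_part_stairs by (rule st.stairs_def)
    show "length (?lam t) = k + t" unfolding eq by (rule st.length_lam)
  qed
  have conv: "\<exists>t\<in>{1..mu - 2 * k}. lam = ?lam t"
    if p: "is_partition (sum_list lam) lam" and D: "D_part TYPE('a) lam = ?stairs" for lam
  proof -
    have lam: "sorted_wrt (\<ge>) lam" "\<forall>x\<in>set lam. 0 < x" using p by (auto simp: is_partition_def)
    have le: "sum_list (map (chain_weight a) lam) \<le> mu" if "Suc a \<in> set lam" for a
      using D_part_chain[OF lam that, where 'a = 'a] unfolding D by auto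
    have gap: "card T \<le> Suc k" if "T \<subseteq> set lam" "\<And>x y. x \<in> T \<Longrightarrow> y \<in> T \<Longrightarrow> x < y \<Longrightarrow> x + 2 \<le> y" for T
      using D_part_length_ge[OF lam that, where 'a = 'a] unfolding D by simp
    have "is_partition (sum_list lam) ?stairs"
      using D_part_partition[OF lam, where 'a = 'a] unfolding D .
    \<comment> \<open>D(\<lambda>) is a partition of the same number as \<open>lam\<close>, so the
      total size is known.\<close>
    hence "(\<Sum>i<Suc k. mu - 2 * i) \<le> sum_list lam"
      unfolding is_partition_def sum_list_map_upt by linarith
    from staircase_of_bounds[OF lam assms le gap this]
    obtain t where t: "1 \<le> t" "t \<le> mu - 2 * k"
      and eq: "lam = map (\<lambda>i. mu - 2 * i) [0..<k] @ map (near_equal (mu - 2 * k) t) [0..<t]" by blast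
    have "lam = ?lam t" using eq r_part_eq[OF t] by simp
    thus ?thesis using t by auto
  qed
  have "{lam. is_partition (sum_list ?stairs) lam \<and> D_part TYPE('a) lam = ?stairs} = ?lam ` {1..mu - 2 * k}"
    (is "?A = ?B")
  proof
    show "?A \<subseteq> ?B"
    proof
      fix lam assume "lam \<in> ?A"
      hence "is_partition (sum_list lam) lam" "D_part TYPE('a) lam = ?stairs" by (auto simp: is_partition_def)
      thus "lam \<in> ?B" using conv by blast
    qed
    show "?B \<subseteq> ?A" using stairs by blast
  qed
  \<comment> \<open>The parameter \<open>t\<close> can be read off from the length
    \<open>k + t\<close>.\<close>
  moreover have "inj_on ?lam {1..mu - 2 * k}"
    by (rule inj_onI) (metis stairs(3) add_left_cancel)
  ultimately have "card ?A = mu - 2 * k" by (simp add: card_image)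
  moreover have "D_part TYPE('a) lam = ?stairs \<longleftrightarrow> (\<exists>t\<in>{1..mu - 2 * k}. lam = ?lam t)"
    if "is_partition (sum_list lam) lam" for lam
    using conv[OF that] stairs(2) by blast
  ultimately show ?thesis by blast
qed

end
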